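(* Let $n\ge 2$, let $M(z,\bar z)\in\mathbb C[z_1,\dots,z_n,\bar z_1,\dots,\bar z_n]$ be a non-zero bihomogeneous Hermitian polynomial of rank $r$, let $\|z\|_\star^2=\langle z,z\rangle_\star$ where $\langle\cdot,\cdot\rangle_\star$ is a Hermitian form on $\mathbb C^n$ of signature $(s,t)$ with $s,t\ge 0$ and $s+t=n$, and let $R$ be the rank of $M(z,\bar z)\|z\|_\star^2$. Then $$2\,r_{(n-1)}|_0^{1}-rn\le R\le rn.$$
   Context: A polynomial $M(z,\bar z)\in\mathbb C[z_1,\dots,z_n,\bar z_1,\dots,\bar z_n]$ is Hermitian if it is real-valued, and bihomogeneous of bidegree $(d,d)$ if it is homogeneous of degree $d$ in $z$ and homogeneous of degree $d$ in $\bar z$. Such an $M$ can be written $M(z,\bar z)=Z_d^H\mathcal M Z_d$, where $Z_d$ is the vector of all monomials of degree $d$ in $z_1,\dots,z_n$ and $\mathcal M$ is a Hermitian matrix; the rank of $M$ is the rank of $\mathcal M$. The form is, up to a linear change of coordinates, $\|z\|_{s,t}^2=|z_1|^2+\cdots+|z_s|^2-|z_{s+1}|^2-\cdots-|z_{s+t}|^2$. Macaulay representation: for positive integers $A$ and $N$ there exist a unique integer $\delta$ with $1\le\delta\le N$ and unique integers $a_N>a_{N-1}>\cdots>a_\delta>0$ with $a_j\ge j$ for every $j$ such that $A=\binom{a_N}{N}+\cdots+\binom{a_\delta}{\delta}$. For integers $\sigma,\tau$ define $A_{(N)}|_\sigma^\tau=\binom{a_N+\tau}{N+\sigma}+\cdots+\binom{a_\delta+\tau}{\delta+\sigma}$.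 *)

theory Defs
  imports
    Complex_Main
    "HOL-Library.Poly_Mapping"
    "HOL-Library.Product_Plus"
    "Jordan_Normal_Form.DL_Rank"
begin

type_synonym monomial = "nat \<Rightarrow>\<^sub>0 nat"

text \<open>
  A polynomial in $z$ and $\bar z$ is a finitely supported coefficient function, the pair
  \<open>(\<alpha>, \<beta>)\<close> being the exponent of $z^\alpha \bar z^\beta$. Since exponent pairs add
  componentwise, \<open>*\<close> on this type is multiplication of polynomials. The variables
  $z_1, \dots, z_n$ are numbered \<open>0, \<dots>, n - 1\<close>, as are the entries of vectors.
\<close>

type_synonym zpoly = "(monomial \<times> monomial) \<Rightarrow>\<^sub>0 complex"

definition mdeg :: "monomial \<Rightarrow> nat" where
  "mdeg \<alpha> = (\<Sum>i\<in>Poly_Mapping.keys \<alpha>. Poly_Mapping.lookup \<alpha> i)"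

definition zpolys :: "nat \<Rightarrow> zpoly set" where
  "zpolys n = {M. \<forall>(\<alpha>, \<beta>)\<in>Poly_Mapping.keys M. Poly_Mapping.keys \<alpha> \<subseteq> {..<n} \<and> Poly_Mapping.keys \<beta> \<subseteq> {..<n}}"

definition bihomogeneous :: "nat \<Rightarrow> zpoly \<Rightarrow> bool" where
  "bihomogeneous d M \<longleftrightarrow> (\<forall>(\<alpha>, \<beta>)\<in>Poly_Mapping.keys M. mdeg \<alpha> = d \<and> mdeg \<beta> = d)"

definition meval :: "nat \<Rightarrow> monomial \<Rightarrow> complex vec \<Rightarrow> complex" where
  "meval n \<alpha> z = (\<Prod>i<n. (z $ i) ^ Poly_Mapping.lookup \<alpha> i)"

definition zeval :: "nat \<Rightarrow> zpoly \<Rightarrow> complex vec \<Rightarrow> complex" where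
  "zeval n M z = (\<Sum>(\<alpha>, \<beta>)\<in>Poly_Mapping.keys M. Poly_Mapping.lookup M (\<alpha>, \<beta>) * meval n \<alpha> z * cnj (meval n \<beta> z))"

definition hermitian_poly :: "nat \<Rightarrow> zpoly \<Rightarrow> bool" where
  "hermitian_poly n M \<longleftrightarrow> (\<forall>z\<in>carrier_vec n. zeval n M z \<in> \<real>)"

definition monomials :: "nat \<Rightarrow> nat \<Rightarrow> monomial set" where
  "monomials n d = {\<alpha>. Poly_Mapping.keys \<alpha> \<subseteq> {..<n} \<and> mdeg \<alpha> = d}"

text \<open>
  The vector $Z_d$: the monomials of degree \<open>d\<close>, listed in the lexicographic order of exponents.
\<close>

definition monomial_list :: "nat \<Rightarrow> nat \<Rightarrow> monomial list" where
  "monomial_list n d = sorted_list_of_set (monomials n d)"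

text \<open>
  In $Z_d^H \mathcal{M} Z_d$ the rows of $\mathcal{M}$ belong to the conjugated monomials, the
  columns to the holomorphic ones.
\<close>

definition coeff_matrix :: "nat \<Rightarrow> nat \<Rightarrow> zpoly \<Rightarrow> complex mat" where
  "coeff_matrix n d M = (let ms = monomial_list n d in
     mat (length ms) (length ms) (\<lambda>(i, j). Poly_Mapping.lookup M (ms ! j, ms ! i)))"

definition zpoly_rank :: "nat \<Rightarrow> nat \<Rightarrow> zpoly \<Rightarrow> nat" where
  "zpoly_rank n d M = vec_space.rank (length (monomial_list n d)) (coeff_matrix n d M)"

lemma finite_monomials: "finite (monomials n d)"
proof -
  let ?F = "{f. \<forall>i. (i \<in> {..<n} \<longrightarrow> f i \<in> {..d}) \<and> (i \<notin> {..<n} \<longrightarrow> f i = (0::nat))}"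
  have "finite ?F" by (rule finite_set_of_finite_funs) auto
  moreover have "Poly_Mapping.lookup ` monomials n d \<subseteq> ?F"
  proof clarify
    fix \<alpha> i assume a: "\<alpha> \<in> monomials n d"
    have "Poly_Mapping.lookup \<alpha> i \<le> mdeg \<alpha>"
    proof (cases "i \<in> Poly_Mapping.keys \<alpha>")
      case True
      then show ?thesis unfolding mdeg_def by (intro member_le_sum) auto
    qed (simp add: in_keys_iff)
    with a show "(i \<in> {..<n} \<longrightarrow> Poly_Mapping.lookup \<alpha> i \<in> {..d}) \<and> (i \<notin> {..<n} \<longrightarrow> Poly_Mapping.lookup \<alpha> i = 0)"
      by (auto simp: monomials_def in_keys_iff)
  qed
  ultimately have "finite (Poly_Mapping.lookup ` monomials n d)" by (rule finite_subset[rotated])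
  then show ?thesis by (rule finite_imageD) (simp add: inj_on_def)
qed

lemma set_monomial_list: "set (monomial_list n d) = monomials n d"
  by (simp add: monomial_list_def finite_monomials)

lemma zeval_coeff_matrix:
  assumes "M \<in> zpolys n" and "bihomogeneous d M"
  defines "ms \<equiv> monomial_list n d"
  shows "zeval n M z = (\<Sum>i<length ms. \<Sum>j<length ms.
    cnj (meval n (ms ! i) z) * coeff_matrix n d M $$ (i, j) * meval n (ms ! j) z)"
proof -
  have bij: "bij_betw ((!) ms) {..<length ms} (monomials n d)"
    unfolding ms_def using set_monomial_list[of n d]
    by (intro bij_betw_nth) (simp_all add: monomial_list_def)
  have sub: "Poly_Mapping.keys M \<subseteq> monomials n d \<times> monomials n d"
    using assms(1,2) by (fastforce simp: zpolys_def bihomogeneous_def monomials_def)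
  have "zeval n M z = (\<Sum>(\<alpha>, \<beta>)\<in>monomials n d \<times> monomials n d.
      Poly_Mapping.lookup M (\<alpha>, \<beta>) * meval n \<alpha> z * cnj (meval n \<beta> z))"
    unfolding zeval_def using sub
    by (intro sum.mono_neutral_left) (auto simp: finite_monomials in_keys_iff)
  also have "\<dots> = (\<Sum>\<beta>\<in>monomials n d. \<Sum>\<alpha>\<in>monomials n d.
      Poly_Mapping.lookup M (\<alpha>, \<beta>) * meval n \<alpha> z * cnj (meval n \<beta> z))"
    by (subst sum.swap) (simp add: sum.cartesian_product)
  also have "\<dots> = (\<Sum>i<length ms. \<Sum>j<length ms.
      Poly_Mapping.lookup M (ms ! j, ms ! i) * meval n (ms ! j) z * cnj (meval n (ms ! i) z))"
    by (simp add: sum.reindex_bij_betw[OF bij, symmetric])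
  also have "\<dots> = (\<Sum>i<length ms. \<Sum>j<length ms.
      cnj (meval n (ms ! i) z) * coeff_matrix n d M $$ (i, j) * meval n (ms ! j) z)"
    by (intro sum.cong refl) (simp add: coeff_matrix_def Let_def flip: ms_def)
  finally show ?thesis .
qed

definition hermitian_form :: "nat \<Rightarrow> (complex vec \<Rightarrow> complex vec \<Rightarrow> complex) \<Rightarrow> bool" where
  "hermitian_form n B \<longleftrightarrow>
     (\<forall>x\<in>carrier_vec n. \<forall>y\<in>carrier_vec n. \<forall>w\<in>carrier_vec n. B (x + y) w = B x w + B y w) \<and>
     (\<forall>c. \<forall>x\<in>carrier_vec n. \<forall>w\<in>carrier_vec n. B (c \<cdot>\<^sub>v x) w = c * B x w) \<and>
     (\<forall>x\<in>carrier_vec n. \<forall>y\<in>carrier_vec n. B y x = cnj (B x y))"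

text \<open>
  Signature \<open>(s, t)\<close>: in the linear coordinates \<open>w = A z\<close> the form is
  $|w_1|^2 + \dots + |w_s|^2 - |w_{s+1}|^2 - \dots - |w_{s+t}|^2$.
\<close>

definition signature :: "nat \<Rightarrow> (complex vec \<Rightarrow> complex vec \<Rightarrow> complex) \<Rightarrow> nat \<Rightarrow> nat \<Rightarrow> bool" where
  "signature n B s t \<longleftrightarrow> s + t \<le> n \<and>
     (\<exists>A\<in>carrier_mat n n. invertible_mat A \<and>
        (\<forall>z\<in>carrier_vec n. B z z =
           of_real ((\<Sum>i<s. (cmod ((A *\<^sub>v z) $ i))\<^sup>2) - (\<Sum>i=s..<s+t. (cmod ((A *\<^sub>v z) $ i))\<^sup>2))))"

text \<open>
  $\|z\|_\star^2 = \langle z, z\rangle_\star$ as a polynomial: by sesquilinearity,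
  $\langle z, z\rangle_\star = \sum_{i,j} \langle e_i, e_j\rangle_\star z_i \bar z_j$.
\<close>

definition norm_poly :: "nat \<Rightarrow> (complex vec \<Rightarrow> complex vec \<Rightarrow> complex) \<Rightarrow> zpoly" where
  "norm_poly n B = (\<Sum>i<n. \<Sum>j<n.
     Poly_Mapping.single (Poly_Mapping.single i 1, Poly_Mapping.single j 1)
       (B (unit_vec n i) (unit_vec n j)))"

lemma zeval_sum:
  assumes "finite I"
  shows "zeval n (\<Sum>i\<in>I. f i) z = (\<Sum>i\<in>I. zeval n (f i) z)"
proof -
  define K where "K = (\<Union>i\<in>I. Poly_Mapping.keys (f i))"
  have fin: "finite K" using assms by (simp add: K_def)
  have eq: "zeval n g z = (\<Sum>(\<alpha>, \<beta>)\<in>K.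
      Poly_Mapping.lookup g (\<alpha>, \<beta>) * meval n \<alpha> z * cnj (meval n \<beta> z))"
    if "Poly_Mapping.keys g \<subseteq> K" for g
    unfolding zeval_def using that fin
    by (intro sum.mono_neutral_left) (auto simp: in_keys_iff)
  have "Poly_Mapping.keys (\<Sum>i\<in>I. f i) \<subseteq> K"
    unfolding K_def by (rule keys_sum)
  then have "zeval n (\<Sum>i\<in>I. f i) z = (\<Sum>p\<in>K. \<Sum>i\<in>I.
      Poly_Mapping.lookup (f i) p * meval n (fst p) z * cnj (meval n (snd p) z))"
    by (simp add: eq lookup_sum sum_distrib_right case_prod_unfold)
  also have "\<dots> = (\<Sum>i\<in>I. zeval n (f i) z)"
  proof (subst sum.swap, intro sum.cong refl)
    fix i assume "i \<in> I"
    then have "Poly_Mapping.keys (f i) \<subseteq> K" by (auto simp: K_def)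
    then show "(\<Sum>p\<in>K. Poly_Mapping.lookup (f i) p * meval n (fst p) z * cnj (meval n (snd p) z))
        = zeval n (f i) z" by (simp add: eq case_prod_unfold)
  qed
  finally show ?thesis .
qed

lemma meval_single:
  assumes "i < n"
  shows "meval n (Poly_Mapping.single i 1) z = z $ i"
proof -
  have "meval n (Poly_Mapping.single i 1) z = (\<Prod>k<n. if k = i then z $ k else 1)"
    unfolding meval_def by (intro prod.cong refl) (simp add: lookup_single when_def)
  then show ?thesis using assms by simp
qed

lemma zeval_norm_poly:
  assumes B: "hermitian_form n B" and z: "z \<in> carrier_vec n"
  shows "zeval n (norm_poly n B) z = B z z"
proof -
  have add: "B (x + y) w = B x w + B y w" and scale: "B (c \<cdot>\<^sub>v x) w = c * B x w"
    and sym: "B y x = cnj (B x y)"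
    if "x \<in> carrier_vec n" "y \<in> carrier_vec n" "w \<in> carrier_vec n" for x y w c
    using B that unfolding hermitian_form_def by blast+
  have left: "B z w = (\<Sum>i<n. z $ i * B (unit_vec n i) w)" if w: "w \<in> carrier_vec n" for w
  proof -
    define p where "p k = vec n (\<lambda>i. if i < k then z $ i else 0)" for k
    have p: "p k \<in> carrier_vec n" for k by (simp add: p_def)
    have "B (p k) w = (\<Sum>i<k. z $ i * B (unit_vec n i) w)" if "k \<le> n" for k
      using that
    proof (induction k)
      case 0
      have "p 0 = 0 \<cdot>\<^sub>v p 0" by (auto simp: p_def)
      then have "B (p 0) w = 0 * B (p 0) w" using scale[OF p p w] by metis
      then show ?case by simp
    next
      case (Suc k)
      have "p (Suc k) = p k + z $ k \<cdot>\<^sub>v unit_vec n k"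
        using Suc.prems by (auto simp: p_def less_Suc_eq)
      then show ?case using Suc w p by (simp add: add scale[of _ w])
    qed
    moreover have "p n = z" using z by (auto simp: p_def)
    ultimately show ?thesis by auto
  qed
  have right: "B (unit_vec n i) z = (\<Sum>j<n. cnj (z $ j) * B (unit_vec n i) (unit_vec n j))" for i
  proof -
    have "B (unit_vec n i) z = cnj (B z (unit_vec n i))"
      using z by (intro sym) auto
    also have "\<dots> = (\<Sum>j<n. cnj (z $ j) * cnj (B (unit_vec n j) (unit_vec n i)))"
      by (simp add: left)
    also have "\<dots> = (\<Sum>j<n. cnj (z $ j) * B (unit_vec n i) (unit_vec n j))"
      by (intro sum.cong refl arg_cong2[where f = "(*)"] sym[symmetric, where w = z]) (use z in auto)
    finally show ?thesis .
  qed
  have single: "zeval n (Poly_Mapping.single (\<alpha>, \<beta>) c) z = c * meval n \<alpha> z * cnj (meval n \<beta> z)"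
    for \<alpha> \<beta> c by (simp add: zeval_def)
  have "zeval n (norm_poly n B) z
      = (\<Sum>i<n. \<Sum>j<n. B (unit_vec n i) (unit_vec n j) * z $ i * cnj (z $ j))"
    by (simp add: norm_poly_def zeval_sum single meval_single[simplified])
  also have "\<dots> = (\<Sum>i<n. z $ i * B (unit_vec n i) z)"
    by (simp add: right sum_distrib_left mult_ac)
  also have "\<dots> = B z z" using left[OF z] by simp
  finally show ?thesis .
qed

text \<open>
  The usual convention that binomial coefficients vanish outside \<open>0 \<le> k \<le> m\<close>.
\<close>

definition int_choose :: "int \<Rightarrow> int \<Rightarrow> int" where
  "int_choose m k = (if 0 \<le> k \<and> k \<le> m then int (nat m choose nat k) else 0)"

definition macaulay_rep :: "nat \<Rightarrow> nat \<Rightarrow> nat \<Rightarrow> (nat \<Rightarrow> nat) \<Rightarrow> bool" where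
  "macaulay_rep A N \<delta> a \<longleftrightarrow>
     1 \<le> \<delta> \<and> \<delta> \<le> N \<and> strict_mono_on {\<delta>..N} a \<and> 0 < a \<delta> \<and> (\<forall>j\<in>{\<delta>..N}. j \<le> a j) \<and>
     A = (\<Sum>j=\<delta>..N. a j choose j)"

text \<open>
  \<open>macaulay A N \<sigma> \<tau>\<close> is $A_{(N)}|_\sigma^\tau$. Only \<open>\<delta>\<close> and the values of \<open>a\<close> on
  \<open>{\<delta>..N}\<close> are determined by \<open>A\<close> and \<open>N\<close>, and these determine the sum. The value is
  meaningful for positive \<open>A\<close> and \<open>N\<close>.
\<close>

definition macaulay :: "nat \<Rightarrow> nat \<Rightarrow> int \<Rightarrow> int \<Rightarrow> int" where
  "macaulay A N \<sigma> \<tau> =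
     (THE v. \<exists>\<delta> a. macaulay_rep A N \<delta> a \<and>
        v = (\<Sum>j=\<delta>..N. int_choose (int (a j) + \<tau>) (int j + \<sigma>)))"

end

theory Submission
  imports Defs
begin

text \<open>
  A rank factorization writes the coefficients of \<open>M\<close> as \<open>\<Sum>k<r. f\<^sub>k(\<alpha>) g\<^sub>k(\<beta>)\<close> with both families of
  forms linearly independent. The coefficient matrix of the product with $\|z\|_\star^2$ is then
  \<open>F\<^sup>T E G\<close>, where the \<open>rn\<close> rows of \<open>F\<close> and \<open>G\<close> are the forms \<open>z\<^sub>i f\<^sub>k\<close> and \<open>z\<^sub>j g\<^sub>k\<close>, and \<open>E\<close> consists of \<open>r\<close>
  diagonal blocks equal to the invertible matrix of the Hermitian form. Hence \<open>R \<le> rn\<close>, and Frobenius'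
  inequality gives \<open>R \<ge> rank F + rank G - rn\<close>. Both ranks are at least the number of products of
  leading monomials with variables, and \<open>r\<close> monomials have at least $r_{(n-1)}|_0^1$ such products:
  compression reduces this form of Macaulay's theorem to sets that are stable under trading the last
  variable for any other one, and for these one inducts along slices.
\<close>

text \<open>The index \<open>n - 1\<close> and the upper shift by 1 are those of a full degree: n
  variables have e + n - 1 choose n - 1 monomials of degree e, and their products with the variables
  number e + n choose n - 1. The degree does not occur in the bound, so the counting is done for
  arbitrary finite sets of exponents, by induction on the number of variables. The obstacle there is
  that the sizes of the two slices are unknown; only an inequality between them is available, and
  the arithmetic below turns it into the bound. The factor 2 comes from F and G, which contribute
  \<open>r + shadow (n - 1) r\<close> each. The subtracted rn is the inner dimension in Frobenius'
  inequality and pays for the cancellation that an indefinite form can cause. Neither rank is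
  computed: it suffices that the columns of F and G at the products of leading monomials are
  independent. This is a triangularity, because the order of exponents is invariant under addition:
  if a is the leading monomial of h, then a times z_i is that of z_i h.\<close>

section \<open>Arithmetic of the Macaulay representation\<close>

text \<open>
  The greedy form of the Kruskal--Katona shadow: if \<open>a\<^sub>m > \<dots> > a\<^sub>\<delta>\<close> is the Macaulay
  representation of \<open>r\<close>, this is the sum of the \<open>a\<^sub>j choose (j - 1)\<close>, so that by Pascal's rule
  $r_{(m)}|_0^1$ is \<open>r + shadow m r\<close>.
\<close>

primrec shadow :: "nat \<Rightarrow> nat \<Rightarrow> nat" where
  "shadow 0 r = 0"
| "shadow (Suc m) r = (if r = 0 then 0 else
     let a = (GREATEST a. a choose Suc m \<le> r) in (a choose m) + shadow m (r - (a choose Suc m)))"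

lemma shadow_0 [simp]: "shadow m 0 = 0"
  by (cases m) auto

text \<open>Binomials grow without bound in their upper index, so there is a least one beyond
  \<open>r\<close>; the index before it is the leading entry of the greedy expansion.\<close>

lemma binomial_block_exists:
  assumes "1 \<le> r"
  obtains a where "Suc m \<le> a" "a choose Suc m \<le> r" "r < Suc a choose Suc m"
proof -
  have ex: "\<exists>b\<ge>Suc m. k < b choose Suc m" for k
  proof (induction k)
    case 0
    show ?case by (intro exI[of _ "Suc m"]) simp
  next
    case (Suc k)
    then obtain b where b: "b \<ge> Suc m" "k < b choose Suc m" by blast
    then have "b choose m > 0" by (simp add: zero_less_binomial_iff)
    with b show ?case by (intro exI[of _ "Suc b"]) (simp del: zero_less_binomial_iff)
  qed
  define b where "b = (LEAST b. r < b choose Suc m)"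
  have b: "r < b choose Suc m"
    unfolding b_def using ex[of r] by (metis (lifting) LeastI)
  have "b > Suc m"
  proof (rule ccontr)
    assume "\<not> b > Suc m"
    then have "b choose Suc m \<le> Suc m choose Suc m" by (intro binomial_right_mono) auto
    with b assms show False by simp
  qed
  then obtain a where a: "b = Suc a" "Suc m \<le> a" by (cases b) auto
  have "\<not> r < a choose Suc m"
    using not_less_Least[of a "\<lambda>b. r < b choose Suc m"] a by (simp add: b_def)
  with a b that[of a] show ?thesis by simp
qed

text \<open>By Pascal's rule \<open>r < a choose m\<close> keeps the total below
  \<open>Suc a choose Suc m\<close>, so the greedy choice is exactly \<open>a\<close>.\<close>

lemma shadow_block_strict:
  assumes "Suc m \<le> a" "r < a choose m"
  shows "shadow (Suc m) ((a choose Suc m) + r) = (a choose m) + shadow m r"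
proof -
  have "(GREATEST b. b choose Suc m \<le> (a choose Suc m) + r) = a"
  proof (rule Greatest_equality)
    fix b assume "b choose Suc m \<le> (a choose Suc m) + r"
    with assms have less: "b choose Suc m < Suc a choose Suc m" by simp
    show "b \<le> a"
    proof (rule ccontr)
      assume "\<not> b \<le> a"
      then have "Suc a choose Suc m \<le> b choose Suc m" by (intro binomial_right_mono) auto
      with less show False by simp
    qed
  qed simp
  moreover have "a choose Suc m > 0" using assms by simp
  ultimately show ?thesis by simp
qed

declare shadow.simps(2) [simp del]

lemma shadow_binomial:
  assumes "Suc m \<le> a"
  shows "shadow (Suc m) (a choose Suc m) = a choose m"
  using shadow_block_strict[of m a 0] assms by simp

text \<open>At the end of the block the greedy choice jumps to \<open>Suc a\<close>, but by Pascal's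
  rule both expressions still agree. The closed block is what allows steps from \<open>r\<close> to
  \<open>Suc r\<close> and tails that are bounded only by \<le>.\<close>

lemma shadow_block:
  assumes "Suc m \<le> a" "r \<le> a choose m"
  shows "shadow (Suc m) ((a choose Suc m) + r) = (a choose m) + shadow m r"
proof (cases "r = a choose m")
  case True
  have "shadow (Suc m) ((a choose Suc m) + r) = Suc a choose m"
    using shadow_binomial[of m "Suc a"] assms True by (simp add: add.commute)
  moreover have "Suc a choose m = (a choose m) + shadow m r"
    using True shadow_binomial[of "m - 1" a] assms by (cases m) auto
  ultimately show ?thesis by simp
qed (use assms shadow_block_strict in simp)

lemma block_cases:
  assumes "1 \<le> r"
  obtains a r' where "Suc m \<le> a" "r = (a choose Suc m) + r'" "r' < a choose m"
proof -
  obtain a where a: "Suc m \<le> a" "a choose Suc m \<le> r" "r < Suc a choose Suc m"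
    using binomial_block_exists[OF assms] .
  then show ?thesis using that[of a "r - (a choose Suc m)"] by simp
qed

text \<open>For positive \<open>r\<close>, both \<open>r\<close> and \<open>Suc r\<close> lie in a
  common closed block, so the comparison passes to the remainders one level down.\<close>

lemma shadow_Suc_mono: "shadow m r \<le> shadow m (Suc r)"
proof (induction m arbitrary: r)
  case (Suc m)
  show ?case
  proof (cases "r = 0")
    case False
    then obtain a r' where a: "Suc m \<le> a" "r = (a choose Suc m) + r'" "r' < a choose m"
      using block_cases[of r m] by auto
    then show ?thesis
      using shadow_block[of m a r'] shadow_block[of m a "Suc r'"] Suc[of r'] by simp
  qed simp
qed simp

lemma shadow_mono: "r \<le> r' \<Longrightarrow> shadow m r \<le> shadow m r'"
  by (rule lift_Suc_mono_le[of "shadow m"]) (auto intro: shadow_Suc_mono)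

lemma shadow_Suc_1: "shadow (Suc m) 1 = Suc m"
  using shadow_binomial[of m "Suc m"] by simp

text \<open>
  The witness \<open>y\<close> is obtained by lowering every \<open>a\<^sub>j\<close> by one: it is the sum of the
  \<open>(a\<^sub>j - 1) choose (j - 1)\<close>, the size of the bottom slice of an extremal set. The two clauses
  about \<open>b\<close> only keep the induction inside one block of \<open>shadow_block\<close>.
\<close>

lemma shadow_split:
  assumes "1 \<le> r"
  shows "\<exists>y. 1 \<le> y \<and> y \<le> r \<and> shadow (Suc m) r \<le> y + shadow m y
     \<and> y \<le> shadow (Suc m) (Suc (r - y))
     \<and> (\<forall>b\<ge>Suc m. r \<le> b choose Suc m \<longrightarrow> y \<le> (b - 1) choose m)
     \<and> (\<forall>b\<ge>Suc m. r < b choose Suc m \<longrightarrow> Suc (r - y) \<le> (b - 1) choose Suc m)"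
  using assms
proof (induction m arbitrary: r)
  case 0
  have eq: "shadow (Suc 0) (Suc k) = 1" for k
    using shadow_binomial[of 0 "Suc k"] by simp
  obtain k where "r = Suc k" using 0 by (cases r) auto
  \<comment> \<open>Here r is r choose 1, and lowering its entry gives y = (r - 1) choose 0 =
    1.\<close>
  then show ?case by (intro exI[of _ 1]) (auto simp: eq)
next
  case (Suc m r)
  obtain a r' where a: "Suc (Suc m) \<le> a" "r = (a choose Suc (Suc m)) + r'" "r' < a choose Suc m"
    using block_cases[OF Suc.prems, of "Suc m"] .
  obtain c where c: "a = Suc c" "Suc m \<le> c" using a by (cases a) auto
  have sh: "shadow (Suc (Suc m)) r = (a choose Suc m) + shadow (Suc m) r'"
    using a shadow_block[of "Suc m" a r'] by simp
  have pos: "c choose Suc m > 0" using c by simp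
  have below: "a < b" if "r < b choose Suc (Suc m)" for b
  proof (rule ccontr)
    assume "\<not> a < b"
    then have "b choose Suc (Suc m) \<le> a choose Suc (Suc m)" by (intro binomial_right_mono) auto
    with that a show False by simp
  qed
  show ?case
  proof (cases "r' = 0")
    case True
    let ?y = "c choose Suc m"
    have r: "r = (c choose Suc (Suc m)) + ?y" using True a c by simp
    have "shadow (Suc (Suc m)) r = ?y + shadow (Suc m) ?y"
      using sh True c shadow_binomial[of m c] by simp
    moreover have "?y \<le> shadow (Suc (Suc m)) (Suc (r - ?y))"
    proof (cases "c = Suc m")
      case True
      then show ?thesis using shadow_Suc_1[of "Suc m"] r by (simp add: binomial_eq_0)
    next
      case False
      then have "shadow (Suc (Suc m)) (r - ?y) = ?y"
        using shadow_binomial[of "Suc m" c] c r by simp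
      then show ?thesis using shadow_Suc_mono[of "Suc (Suc m)" "r - ?y"] by simp
    qed
    moreover have "?y \<le> (b - 1) choose Suc m"
      if "Suc (Suc m) \<le> b" "r \<le> b choose Suc (Suc m)" for b
    proof -
      have "a \<le> b"
      proof (rule ccontr)
        assume *: "\<not> a \<le> b"
        then have "b choose Suc (Suc m) \<le> c choose Suc (Suc m)" using c by (intro binomial_right_mono) auto
        with that r pos show False by simp
      qed
      then show ?thesis using c by (intro binomial_right_mono) auto
    qed
    moreover have "Suc (r - ?y) \<le> (b - 1) choose Suc (Suc m)"
      if "r < b choose Suc (Suc m)" for b
    proof -
      have "Suc (r - ?y) \<le> Suc c choose Suc (Suc m)" using r pos by (simp del: zero_less_binomial_iff add: Suc_le_eq)
      also have "\<dots> \<le> (b - 1) choose Suc (Suc m)" using below[OF that] c by (intro binomial_right_mono) auto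
      finally show ?thesis .
    qed
    moreover have "1 \<le> ?y" using pos by linarith
    ultimately show ?thesis using r by (intro exI[of _ ?y] conjI allI impI) simp_all
  next
    case False
    then obtain y' where y': "1 \<le> y'" "y' \<le> r'" "shadow (Suc m) r' \<le> y' + shadow m y'"
      "y' \<le> shadow (Suc m) (Suc (r' - y'))"
      and y1: "\<And>b. b \<ge> Suc m \<Longrightarrow> r' \<le> b choose Suc m \<Longrightarrow> y' \<le> (b - 1) choose m"
      and y2: "\<And>b. b \<ge> Suc m \<Longrightarrow> r' < b choose Suc m \<Longrightarrow> Suc (r' - y') \<le> (b - 1) choose Suc m"
      using Suc.IH[of r'] by auto
    let ?y = "(c choose Suc m) + y'"
    \<comment> \<open>The clauses about \<open>b\<close>, taken at \<open>b = a\<close>, keep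
      \<open>y'\<close> and \<open>Suc (r' - y')\<close> within the closed blocks of
      \<open>c\<close>, so that \<open>shadow_block\<close> can evaluate the shadows of
      \<open>?y\<close> and \<open>Suc (r - ?y)\<close>.\<close>
    have y'c: "y' \<le> c choose m" "Suc (r' - y') \<le> c choose Suc m"
      using y1[of a] y2[of a] a c by auto
    have r: "r - ?y = (c choose Suc (Suc m)) + (r' - y')" "?y \<le> r" using a c y' by auto
    have "shadow (Suc m) ?y = (c choose m) + shadow m y'"
      using shadow_block[of m c y'] c y'c by simp
    then have "shadow (Suc (Suc m)) r \<le> ?y + shadow (Suc m) ?y"
      using sh y' c by simp
    moreover have "?y \<le> shadow (Suc (Suc m)) (Suc (r - ?y))"
    \<comment> \<open>For \<open>c = Suc m\<close> the lowered top term
      \<open>c choose Suc (Suc m)\<close> is 0 and \<open>shadow_block\<close> does not apply. Then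
      \<open>Suc (r - ?y)\<close> is 1, its shadow is m + 2, and \<open>y' \<le> Suc m\<close> just
      suffices.\<close>
    proof (cases "c = Suc m")
      case True
      then have "r' - y' = 0" "y' \<le> Suc m" using y'c by auto
      then show ?thesis using shadow_Suc_1[of "Suc m"] r True by (simp add: binomial_eq_0)
    next
      case False
      then have "shadow (Suc (Suc m)) (Suc (r - ?y)) = (c choose Suc m) + shadow (Suc m) (Suc (r' - y'))"
        using shadow_block[of "Suc m" c "Suc (r' - y')"] c r y'c by simp
      then show ?thesis using y' by simp
    qed
    moreover have "?y \<le> (b - 1) choose Suc m"
      if "Suc (Suc m) \<le> b" "r \<le> b choose Suc (Suc m)" for b
    proof -
      have "a < b"
      proof (rule ccontr)
        assume "\<not> a < b"
        then have "b choose Suc (Suc m) \<le> a choose Suc (Suc m)" by (intro binomial_right_mono) auto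
        with that a False show False by simp
      qed
      then have "Suc c choose Suc m \<le> (b - 1) choose Suc m" using c by (intro binomial_right_mono) auto
      then show ?thesis using y'c by simp
    qed
    moreover have "Suc (r - ?y) \<le> (b - 1) choose Suc (Suc m)"
      if "r < b choose Suc (Suc m)" for b
    proof -
      have "Suc c choose Suc (Suc m) \<le> (b - 1) choose Suc (Suc m)"
        using below[OF that] c by (intro binomial_right_mono) auto
      then show ?thesis using r y'c by simp
    qed
    ultimately show ?thesis using pos r y' by (intro exI[of _ ?y]) auto
  qed
qed

text \<open>The split \<open>z\<close> of \<open>shadow_split\<close> cannot exceed
  \<open>y\<close>: otherwise \<open>Suc (x + y - z) \<le> x\<close>, and monotonicity would give
  \<open>z \<le> shadow (Suc m) x \<le> y\<close>. The bound for \<open>z\<close> then passes up to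
  \<open>y\<close>, again by monotonicity.\<close>

lemma shadow_le_of_balanced:
  assumes "1 \<le> x + y" "shadow (Suc m) x \<le> y"
  shows "shadow (Suc m) (x + y) \<le> y + shadow m y"
proof -
  obtain z where z: "1 \<le> z" "z \<le> x + y" "shadow (Suc m) (x + y) \<le> z + shadow m z"
    "z \<le> shadow (Suc m) (Suc (x + y - z))"
    using shadow_split[OF assms(1), of m] by blast
  have "z \<le> y"
  proof (rule ccontr)
    assume "\<not> z \<le> y"
    then have "shadow (Suc m) (Suc (x + y - z)) \<le> shadow (Suc m) x"
      using z by (intro shadow_mono) auto
    with z assms \<open>\<not> z \<le> y\<close> show False by simp
  qed
  then show ?thesis using z(3) shadow_mono[of z y m] by simp
qed

section \<open>Growth of sets of monomials\<close>

text \<open>Exponents are plain functions, so that compression is a function update. Neither support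
  nor degree is restricted, hence a slice with a fixed nonzero last exponent can be fed unchanged
  into the induction hypothesis for fewer variables.\<close>

definition up :: "nat \<Rightarrow> (nat \<Rightarrow> nat) set \<Rightarrow> (nat \<Rightarrow> nat) set" where
  "up n A = (\<lambda>(u, i). u(i := Suc (u i))) ` (A \<times> {..<n})"

lemma finite_up: "finite A \<Longrightarrow> finite (up n A)"
  by (simp add: up_def)

lemma upI: "u \<in> A \<Longrightarrow> i < n \<Longrightarrow> u(i := Suc (u i)) \<in> up n A"
  unfolding up_def by force

lemma inj_incr: "inj_on (\<lambda>u :: nat \<Rightarrow> nat. u(i := Suc (u i))) A"
proof (rule inj_onI)
  fix u v :: "nat \<Rightarrow> nat"
  assume eq: "u(i := Suc (u i)) = v(i := Suc (v i))"
  have "u k = v k" for k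
    using fun_cong[OF eq, of k] by (cases "k = i") auto
  then show "u = v" by blast
qed

text \<open>
  Compression in the direction of the variables \<open>j\<close> and \<open>m\<close>: on each set of exponents that agree
  outside \<open>j\<close> and \<open>m\<close> and have a given sum of these two entries, the \<open>N\<close> elements of \<open>X\<close> are moved
  to those whose \<open>m\<close>-th entry is \<open>0, \<dots>, N - 1\<close>.
\<close>

definition collapse :: "nat \<Rightarrow> nat \<Rightarrow> (nat \<Rightarrow> nat) \<Rightarrow> nat \<Rightarrow> nat" where
  "collapse j m u = u(j := u j + u m, m := 0)"

definition fibre :: "nat \<Rightarrow> nat \<Rightarrow> (nat \<Rightarrow> nat) set \<Rightarrow> (nat \<Rightarrow> nat) \<Rightarrow> (nat \<Rightarrow> nat) set" where
  "fibre j m X u = {v \<in> X. collapse j m v = collapse j m u}"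

definition level :: "nat \<Rightarrow> nat \<Rightarrow> (nat \<Rightarrow> nat) set \<Rightarrow> (nat \<Rightarrow> nat) \<Rightarrow> nat" where
  "level j m X u = card {v \<in> fibre j m X u. v m < u m}"

definition push :: "nat \<Rightarrow> nat \<Rightarrow> (nat \<Rightarrow> nat) set \<Rightarrow> (nat \<Rightarrow> nat) \<Rightarrow> nat \<Rightarrow> nat" where
  "push j m X u = u(j := u j + u m - level j m X u, m := level j m X u)"

context
  fixes j m :: nat
  assumes neq: "j \<noteq> m"
begin

lemma collapse_eq_iff:
  "collapse j m v = collapse j m u \<longleftrightarrow> (\<forall>i. i \<noteq> j \<longrightarrow> i \<noteq> m \<longrightarrow> v i = u i) \<and> v j + v m = u j + u m"
proof
  assume eq: "collapse j m v = collapse j m u"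
  show "(\<forall>i. i \<noteq> j \<longrightarrow> i \<noteq> m \<longrightarrow> v i = u i) \<and> v j + v m = u j + u m"
  proof (intro conjI allI impI)
    fix i assume "i \<noteq> j" "i \<noteq> m"
    then show "v i = u i" using fun_cong[OF eq, of i] by (simp add: collapse_def)
  next
    show "v j + v m = u j + u m" using fun_cong[OF eq, of j] neq by (simp add: collapse_def)
  qed
qed (auto simp: collapse_def fun_eq_iff)

lemma eq_if_collapse_eq:
  assumes "collapse j m v = collapse j m u" "v m = u m"
  shows "v = u"
proof
  fix i
  show "v i = u i" using assms collapse_eq_iff[of v u] by (cases "i = j"; cases "i = m") auto
qed

lemma inj_on_fibre: "inj_on (\<lambda>v. v m) (fibre j m X u)"
  by (rule inj_onI) (auto simp: fibre_def intro: eq_if_collapse_eq)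

text \<open>Elements of a fibre are told apart by their \<open>m\<close>-th entries, so at most
  \<open>u m\<close> of them lie below \<open>u\<close>. Consequently the subtraction in
  \<open>push\<close> does not truncate.\<close>

lemma level_le: "level j m X u \<le> u m"
proof -
  have "card {v \<in> fibre j m X u. v m < u m} \<le> card {..<u m}"
    by (rule card_inj_on_le[where f = "\<lambda>v. v m"]) (auto intro: inj_on_subset[OF inj_on_fibre])
  then show ?thesis by (simp add: level_def)
qed

text \<open>A missing neighbour leaves the value \<open>u m - 1\<close> unattained in the fibre, so
  one of the \<open>u m\<close> places below \<open>u\<close> stays empty. This is the source of
  strict progress under compression.\<close>

lemma level_less:
  assumes "u m > 0" "u(j := Suc (u j), m := u m - 1) \<notin> X"
  shows "level j m X u < u m"
proof -
  have "v m \<noteq> u m - 1" if "v \<in> fibre j m X u" for v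
  proof
    assume v: "v m = u m - 1"
    have "v = u(j := Suc (u j), m := u m - 1)"
      by (rule eq_if_collapse_eq)
        (use that v neq assms in \<open>auto simp: fibre_def collapse_eq_iff\<close>)
    with that assms show False by (simp add: fibre_def)
  qed
  then have "card {v \<in> fibre j m X u. v m < u m} \<le> card {..<u m - 1}"
    by (intro card_inj_on_le[where f = "\<lambda>v. v m"] inj_on_subset[OF inj_on_fibre[of X u]]) fastforce+
  then show ?thesis using assms by (simp add: level_def)
qed

lemma collapse_push: "collapse j m (push j m X u) = collapse j m u"
  using level_le[of X u] neq by (auto simp: collapse_eq_iff push_def)

lemma push_last: "push j m X u m = level j m X u"
  by (simp add: push_def)

lemma level_strict_mono:
  assumes "finite X" "v \<in> X" "collapse j m v = collapse j m u" "v m < u m"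
  shows "level j m X v < level j m X u"
  unfolding level_def using assms
  by (intro psubset_card_mono) (auto simp: fibre_def)

lemma inj_on_level:
  assumes "finite X"
  shows "inj_on (level j m X) (fibre j m X u)"
proof (rule inj_onI)
  fix v w assume vw: "v \<in> fibre j m X u" "w \<in> fibre j m X u" "level j m X v = level j m X w"
  then have "v m = w m"
    using level_strict_mono[OF assms, of v w] level_strict_mono[OF assms, of w v]
    by (cases "v m" "w m" rule: linorder_cases) (auto simp: fibre_def)
  moreover have "collapse j m v = collapse j m w" using vw(1,2) by (simp add: fibre_def)
  ultimately show "v = w" using eq_if_collapse_eq by blast
qed

lemma inj_on_push:
  assumes "finite X"
  shows "inj_on (push j m X) X"
proof (rule inj_onI)
  fix u v assume uv: "u \<in> X" "v \<in> X" "push j m X u = push j m X v"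
  then have "level j m X u = level j m X v" by (metis push_last)
  moreover have "collapse j m u = collapse j m v" using uv collapse_push by metis
  ultimately show "u = v"
    using inj_on_level[OF assms, of v] uv by (auto simp: inj_on_def fibre_def)
qed

text \<open>On a fibre with N elements \<open>level\<close> is injective with values below N, hence
  onto. Membership in the compressed set thus depends only on fibre sizes, and
  \<open>up_push_image\<close> becomes a comparison of such sizes.\<close>

lemma push_image:
  assumes "finite X"
  shows "push j m X ` X = {u. u m < card (fibre j m X u)}" (is "_ = ?C")
proof
  have fin: "finite (fibre j m X u)" for u using assms by (simp add: fibre_def)
  have less: "level j m X v < card (fibre j m X v)" if "v \<in> X" for v
    unfolding level_def using that by (intro psubset_card_mono fin) (auto simp: fibre_def)
  show "push j m X ` X \<subseteq> ?C"
    using less by (auto simp: push_last fibre_def collapse_push)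
  show "?C \<subseteq> push j m X ` X"
  proof
    fix u assume u: "u \<in> ?C"
    have eq: "fibre j m X v = fibre j m X u" if "v \<in> fibre j m X u" for v
      using that by (auto simp: fibre_def)
    have "level j m X ` fibre j m X u \<subseteq> {..<card (fibre j m X u)}"
      using less eq by (force simp: fibre_def)
    then have "level j m X ` fibre j m X u = {..<card (fibre j m X u)}"
      by (intro card_subset_eq) (auto simp: card_image[OF inj_on_level[OF assms]])
    then have "u m \<in> level j m X ` fibre j m X u" using u by simp
    then obtain v where v: "v \<in> fibre j m X u" "level j m X v = u m" by force
    have "push j m X v = u"
      by (rule eq_if_collapse_eq)
        (use v in \<open>auto simp: collapse_push push_last fibre_def\<close>)
    with v show "u \<in> push j m X ` X" by (auto simp: fibre_def)
  qed
qed

lemma card_push_image: "finite X \<Longrightarrow> card (push j m X ` X) = card X"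
  by (rule card_image) (rule inj_on_push)

text \<open>Multiplication by a variable other than \<open>m\<close> embeds the fibre of
  \<open>u\<close> into that of \<open>u'\<close>, while the \<open>m\<close>-th entry stays. For
  \<open>i = m\<close> the entry rises by one and the fibre must gain an element: besides the
  products with variable \<open>j\<close> it contains the product with variable \<open>m\<close> of
  the element whose \<open>m\<close>-th entry is largest, and this is new.\<close>

lemma up_push_image:
  assumes fin: "finite X" and jn: "j < n" "m < n"
  shows "up n (push j m X ` X) \<subseteq> push j m (up n X) ` up n X"
proof
  fix u' assume "u' \<in> up n (push j m X ` X)"
  then obtain u i where u: "u m < card (fibre j m X u)" and i: "i < n" "u' = u(i := Suc (u i))"
    unfolding push_image[OF fin] by (auto simp: up_def)
  have fin': "finite (fibre j m (up n X) w)" for w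
    using finite_up[OF fin, of n] by (simp add: fibre_def)
  let ?g = "\<lambda>k v. v(k := Suc (v k))"
  have "u' m < card (fibre j m (up n X) u')"
  proof (cases "i = m")
    case False
    have "?g i ` fibre j m X u \<subseteq> fibre j m (up n X) u'"
    proof
      fix w assume "w \<in> ?g i ` fibre j m X u"
      then obtain v where v: "v \<in> X" "collapse j m v = collapse j m u" "w = ?g i v"
        by (auto simp: fibre_def)
      then show "w \<in> fibre j m (up n X) u'"
        using i False upI[OF v(1) i(1)] by (auto simp: fibre_def collapse_eq_iff)
    qed
    then have "card (?g i ` fibre j m X u) \<le> card (fibre j m (up n X) u')"
      by (rule card_mono[OF fin'])
    then have "card (fibre j m X u) \<le> card (fibre j m (up n X) u')"
      by (simp only: card_image[OF inj_incr])
    then show ?thesis using u i False by simp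
  next
    case True
    let ?F = "fibre j m X u"
    have "card ?F > 0" using u by simp
    then have F: "finite ?F" "?F \<noteq> {}" by (simp_all add: card_gt_0_iff)
    then have "Max ((\<lambda>v. v m) ` ?F) \<in> (\<lambda>v. v m) ` ?F" by (intro Max_in) auto
    then obtain w where w: "w \<in> ?F" and max: "w m = Max ((\<lambda>v. v m) ` ?F)" by force
    have w_max: "v m \<le> w m" if "v \<in> ?F" for v using that F(1) by (simp add: max)
    have "?g m w \<notin> ?g j ` ?F"
    proof
      assume "?g m w \<in> ?g j ` ?F"
      then obtain v where v: "v \<in> ?F" "?g m w = ?g j v" by blast
      then have "Suc (w m) = v m" using neq by (metis fun_upd_apply)
      with w_max[OF v(1)] show False by simp
    qed
    then have "Suc (card ?F) = card (insert (?g m w) (?g j ` ?F))"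
      using F by (simp add: card_image[OF inj_incr])
    also have "\<dots> \<le> card (fibre j m (up n X) u')"
    proof (rule card_mono[OF fin'])
      have "?g k v \<in> fibre j m (up n X) u'" if "v \<in> ?F" "k = j \<or> k = m" for k v
      proof -
        have "v \<in> X" using that(1) by (simp add: fibre_def)
        then have "?g k v \<in> up n X" using that(2) jn upI by blast
        then show ?thesis using i True that neq by (auto simp: fibre_def collapse_eq_iff)
      qed
      then show "insert (?g m w) (?g j ` ?F) \<subseteq> fibre j m (up n X) u'" using w by blast
    qed
    finally show ?thesis using u i True by simp
  qed
  then show "u' \<in> push j m (up n X) ` up n X"
    unfolding push_image[OF finite_up[OF fin]] by simp
qed

lemma card_up_push_image:
  assumes "finite X" "j < n" "m < n"
  shows "card (up n (push j m X ` X)) \<le> card (up n X)"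
  using card_mono[OF _ up_push_image[OF assms]] card_push_image[of "up n X"] finite_up[of X n] assms
  by simp

lemma sum_push_image_less:
  assumes "finite X" "u \<in> X" "u m > 0" "u(j := Suc (u j), m := u m - 1) \<notin> X"
  shows "(\<Sum>v\<in>push j m X ` X. v m) < (\<Sum>v\<in>X. v m)"
proof -
  have "(\<Sum>v\<in>push j m X ` X. v m) = (\<Sum>v\<in>X. level j m X v)"
    using inj_on_push[OF assms(1)] by (simp add: sum.reindex push_last)
  also have "\<dots> < (\<Sum>v\<in>X. v m)"
    using assms level_le level_less[of u X] by (intro sum_strict_mono_ex1 bexI[of _ u]) auto
  finally show ?thesis .
qed

end

definition stable :: "nat \<Rightarrow> (nat \<Rightarrow> nat) set \<Rightarrow> bool" where
  "stable m A \<longleftrightarrow> (\<forall>u\<in>A. u m > 0 \<longrightarrow> (\<forall>j<m. u(j := Suc (u j), m := u m - 1) \<in> A))"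

text \<open>The total of the last exponents is a termination measure: every violation of stability
  permits a compression that lowers it, preserves the size and does not enlarge the set of
  products.\<close>

lemma stable_exists:
  assumes "finite A"
  shows "\<exists>A'. finite A' \<and> card A' = card A \<and> card (up (Suc m) A') \<le> card (up (Suc m) A) \<and> stable m A'"
  using assms
proof (induction "\<Sum>u\<in>A. u m" arbitrary: A rule: less_induct)
  case less
  show ?case
  proof (cases "stable m A")
    case False
    then obtain u j where u: "u \<in> A" "u m > 0" "j < m" "u(j := Suc (u j), m := u m - 1) \<notin> A"
      unfolding stable_def by blast
    then have neq: "j \<noteq> m" by simp
    let ?A = "push j m A ` A"
    have A: "finite ?A" "card ?A = card A" "card (up (Suc m) ?A) \<le> card (up (Suc m) A)"
      using less.prems card_push_image[OF neq] card_up_push_image[OF neq, of A "Suc m"] u by auto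
    have "(\<Sum>u\<in>?A. u m) < (\<Sum>u\<in>A. u m)"
      using sum_push_image_less[OF neq less.prems u(1,2,4)] .
    from less.hyps[OF this A(1)] obtain A' where "finite A'" "card A' = card ?A"
      "card (up (Suc m) A') \<le> card (up (Suc m) ?A)" "stable m A'" by blast
    with A show ?thesis by (intro exI[of _ A']) simp
  qed (use less.prems in blast)
qed

text \<open>
  For stable \<open>A\<close>, let \<open>S\<close> be the slice on which the last exponent is minimal and \<open>T\<close> the rest. All
  products of \<open>T\<close> with variables lie in the product of \<open>A\<close> with the last variable, so by induction the
  shadow of \<open>card T\<close> is at most \<open>card S\<close>, and \<open>shadow_le_of_balanced\<close> applies.
\<close>

theorem card_up_ge:
  assumes "finite A"
  shows "card A + shadow m (card A) \<le> card (up (Suc m) A)"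
  using assms
proof (induction m arbitrary: A)
  case 0
  have "(\<lambda>u. u(0 := Suc (u 0))) ` A \<subseteq> up (Suc 0) A" by (auto intro: upI)
  then have "card ((\<lambda>u. u(0 := Suc (u 0))) ` A) \<le> card (up (Suc 0) A)"
    using 0 by (intro card_mono finite_up)
  then show ?case by (simp add: card_image[OF inj_incr])
next
  case (Suc m)
  let ?M = "Suc m"
  from Suc.prems show ?case
  proof (induction "card A" arbitrary: A rule: less_induct)
    case less
    show ?case
    proof (cases "A = {}")
      case False
      obtain B where B: "finite B" "card B = card A" "card (up (Suc ?M) B) \<le> card (up (Suc ?M) A)"
        "stable ?M B" using stable_exists[OF less.prems] by blast
      then have ne: "B \<noteq> {}" using False less.prems by auto
      \<comment> \<open>Taking the minimum instead of 0 makes \<open>S\<close> nonempty, so the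
        inner induction applies to \<open>T\<close>. The last exponents in \<open>T\<close> exceed
        \<open>k\<close> and are therefore positive, as trading requires.\<close>
      define k where "k = Min ((\<lambda>u. u ?M) ` B)"
      have k: "k \<le> u ?M" if "u \<in> B" for u using that B by (simp add: k_def)
      have "k \<in> (\<lambda>u. u ?M) ` B" unfolding k_def using B ne by (intro Min_in) auto
      define S where "S = {u \<in> B. u ?M = k}"
      define T where "T = B - S"
      let ?g = "\<lambda>u. u(?M := Suc (u ?M))"
      have fin: "finite S" "finite T" using B by (simp_all add: S_def T_def)
      have "S \<noteq> {}" using \<open>k \<in> _\<close> by (auto simp: S_def)
      have "S \<subseteq> B" by (auto simp: S_def)
      then have card: "card B = card T + card S"
        using B(1) fin by (simp add: T_def card_Diff_subset card_mono)
      then have "card T < card A" using \<open>S \<noteq> {}\<close> fin B by (simp add: card_gt_0_iff)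
      then have T: "card T + shadow ?M (card T) \<le> card (up (Suc ?M) T)"
        using less.hyps fin by blast
      have "up (Suc ?M) T \<subseteq> ?g ` B"
      proof
        fix w assume "w \<in> up (Suc ?M) T"
        then obtain u i where u: "u \<in> B" "u ?M \<noteq> k" "i < Suc ?M" and w: "w = u(i := Suc (u i))"
          by (auto simp: up_def T_def S_def)
        have pos: "u ?M > 0" using k[OF u(1)] u(2) by simp
        show "w \<in> ?g ` B"
        proof (cases "i = ?M")
          case False
          then have "u(i := Suc (u i), ?M := u ?M - 1) \<in> B"
            using B(4) u pos by (auto simp: stable_def)
          moreover have "w = ?g (u(i := Suc (u i), ?M := u ?M - 1))"
            using False pos w by (auto simp: fun_eq_iff)
          ultimately show ?thesis by blast
        qed (use u w in auto)
      qed
      then have "card (up (Suc ?M) T) \<le> card (?g ` B)"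
        using B(1) by (intro card_mono) auto
      also have "\<dots> = card B" by (rule card_image[OF inj_incr])
      finally have "shadow ?M (card T) \<le> card S" using T card by simp
      then have bal: "shadow ?M (card T + card S) \<le> card S + shadow m (card S)"
        using \<open>S \<noteq> {}\<close> fin by (intro shadow_le_of_balanced) (auto simp: Suc_le_eq card_gt_0_iff)
      \<comment> \<open>Products of \<open>S\<close> with the other variables keep the last exponent
        \<open>k\<close>, while \<open>?g\<close> raises it above \<open>k\<close>. Both sets can
        therefore be counted in full.\<close>
      have "up ?M S \<inter> ?g ` B = {}"
      proof (rule equals0I)
        fix w assume w: "w \<in> up ?M S \<inter> ?g ` B"
        then have "w \<in> up ?M S" "w \<in> ?g ` B" by blast+
        from this(1) have "w ?M = k" by (auto simp: up_def S_def)
        moreover have "w ?M > k" using \<open>w \<in> ?g ` B\<close> k by (auto simp: less_Suc_eq_le)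
        ultimately show False by simp
      qed
      then have "card (up ?M S) + card B = card (up ?M S \<union> ?g ` B)"
        using fin B finite_up by (simp add: card_Un_disjoint card_image[OF inj_incr])
      also have "\<dots> \<le> card (up (Suc ?M) B)"
      proof (rule card_mono[OF finite_up[OF B(1)]])
        have "u(i := Suc (u i)) \<in> up (Suc ?M) B" if "u \<in> B" "i \<le> ?M" for u i
          using that by (intro upI) auto
        then show "up ?M S \<union> ?g ` B \<subseteq> up (Suc ?M) B"
          using \<open>S \<subseteq> B\<close> unfolding up_def[of ?M S] by (auto simp del: fun_upd_apply)
      qed
      finally show ?thesis using Suc.IH[OF fin(1)] bal card B by simp
    qed simp
  qed
qed

section \<open>Macaulay representations and the shadow function\<close>

lemma macaulay_rep_tail_le:
  assumes "strict_mono_on {\<delta>..N} a" "\<delta> \<le> N" "1 \<le> \<delta>"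
  shows "(\<Sum>j=\<delta>..N. a j choose j) \<le> Suc (a N) choose N"
  using assms(2,1)
proof (induction rule: dec_induct)
  case base
  show ?case by (intro order.trans[OF _ binomial_right_mono[of "a \<delta>" "Suc (a \<delta>)"]]) simp_all
next
  case (step N)
  have "strict_mono_on {\<delta>..N} a"
    using step.prems by (rule monotone_on_subset) auto
  then have "(\<Sum>j=\<delta>..N. a j choose j) \<le> Suc (a N) choose N" by (rule step.IH)
  also have "\<dots> \<le> a (Suc N) choose N"
    using strict_mono_onD[OF step.prems, of N "Suc N"] step.hyps
    by (intro binomial_right_mono) auto
  finally show ?case using step.hyps by simp
qed

text \<open>Strictly increasing entries bound the tail by \<open>a (Suc N) choose N\<close>, so the
  top term and the tail form a closed block, and \<open>shadow_block\<close> peels off one term at a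
  time.\<close>

lemma shadow_macaulay_rep:
  assumes "1 \<le> \<delta>" "\<delta> \<le> N" "strict_mono_on {\<delta>..N} a" "\<forall>j\<in>{\<delta>..N}. j \<le> a j"
  shows "shadow N (\<Sum>j=\<delta>..N. a j choose j) = (\<Sum>j=\<delta>..N. a j choose (j - 1))"
  using assms(2-4)
proof (induction rule: dec_induct)
  case base
  obtain k where "\<delta> = Suc k" using assms(1) by (cases \<delta>) auto
  then show ?case using shadow_binomial[of k "a \<delta>"] base by simp
next
  case (step N)
  have mono: "strict_mono_on {\<delta>..N} a"
    using step.prems(1) by (rule monotone_on_subset) auto
  have "(\<Sum>j=\<delta>..N. a j choose j) \<le> Suc (a N) choose N"
    by (rule macaulay_rep_tail_le[OF mono step.hyps(1) assms(1)])
  also have "\<dots> \<le> a (Suc N) choose N"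
    using strict_mono_onD[OF step.prems(1), of N "Suc N"] step.hyps
    by (intro binomial_right_mono) auto
  finally show ?case
    using shadow_block[of N "a (Suc N)" "\<Sum>j=\<delta>..N. a j choose j"] step.IH[OF mono] step.hyps(1)
      step.prems(2)
    by (simp add: add.commute)
qed

text \<open>The greedy expansion stops at the index \<delta> where the remainder vanishes. The
  remainder is below \<open>c choose N\<close>, which forces the next entry below
  \<open>c\<close>.\<close>

lemma macaulay_rep_exists:
  assumes "1 \<le> r" "1 \<le> N"
  shows "\<exists>\<delta> a. macaulay_rep r N \<delta> a"
  using assms(2,1)
proof (induction N arbitrary: r rule: dec_induct)
  case base
  then show ?case
    by (intro exI[of _ 1] exI[of _ "\<lambda>_. r"]) (auto simp: macaulay_rep_def intro: strict_mono_onI)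
next
  case (step N)
  obtain c r' where c: "Suc N \<le> c" "r = (c choose Suc N) + r'" "r' < c choose N"
    using block_cases[OF step.prems, of N] .
  show ?case
  proof (cases "r' = 0")
    case True
    then show ?thesis using c
      by (intro exI[of _ "Suc N"] exI[of _ "\<lambda>_. c"])
        (auto simp: macaulay_rep_def intro: strict_mono_onI)
  next
    case False
    then obtain \<delta> a where a: "macaulay_rep r' N \<delta> a" using step.IH[of r'] by auto
    then have \<delta>: "\<delta> \<le> N" "1 \<le> \<delta>" by (auto simp: macaulay_rep_def)
    have "a N choose N \<le> r'"
      using a \<delta> unfolding macaulay_rep_def by (auto intro!: member_le_sum)
    then have "a N choose N < c choose N" using c by simp
    then have less: "a N < c"
      by (meson binomial_right_mono linorder_not_less)
    let ?a = "a(Suc N := c)"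
    have mono: "strict_mono_on {\<delta>..N} a" using a by (simp add: macaulay_rep_def)
    have mono': "strict_mono_on {\<delta>..Suc N} ?a"
    proof (rule strict_mono_onI)
      fix i j assume ij: "i \<in> {\<delta>..Suc N}" "j \<in> {\<delta>..Suc N}" "i < j"
      show "?a i < ?a j"
      proof (cases "j = Suc N")
        case True
        have "a i \<le> a N"
          using strict_mono_onD[OF mono, of i N] ij True by (cases "i = N") auto
        then show ?thesis using True ij less by simp
      qed (use ij strict_mono_onD[OF mono, of i j] in auto)
    qed
    have "macaulay_rep r (Suc N) \<delta> ?a"
    proof -
      have "(\<Sum>j=\<delta>..N. ?a j choose j) = r'"
        using a by (auto simp: macaulay_rep_def intro: sum.cong)
      then have "r = (\<Sum>j=\<delta>..Suc N. ?a j choose j)" using \<delta> c(2) by simp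
      moreover have "\<forall>j\<in>{\<delta>..Suc N}. j \<le> ?a j"
        using a c(1) by (auto simp: macaulay_rep_def le_Suc_eq)
      ultimately show ?thesis
        using a \<delta> mono' by (simp add: macaulay_rep_def)
    qed
    then show ?thesis by blast
  qed
qed

text \<open>Every representation of \<open>r\<close> gives the same value
  \<open>r + shadow N r\<close>, an expression free of \<delta> and \<open>a\<close>; together with
  existence this evaluates the definite description.\<close>

lemma macaulay_eq_shadow:
  assumes "1 \<le> r" "1 \<le> N"
  shows "macaulay r N 0 1 = int (r + shadow N r)"
proof -
  have val: "(\<Sum>j=\<delta>..N. int_choose (int (a j) + 1) (int j + 0)) = int (r + shadow N r)"
    if rep: "macaulay_rep r N \<delta> a" for \<delta> a
  proof -
    have *: "1 \<le> \<delta>" "\<delta> \<le> N" "strict_mono_on {\<delta>..N} a" "\<forall>j\<in>{\<delta>..N}. j \<le> a j"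
      "r = (\<Sum>j=\<delta>..N. a j choose j)"
      using rep by (auto simp: macaulay_rep_def)
    have "int_choose (int (a j) + 1) (int j + 0) = int ((a j choose j) + (a j choose (j - 1)))"
      if jd: "j \<in> {\<delta>..N}" for j
    proof -
      obtain k where "j = Suc k" using jd *(1) by (cases j) auto
      moreover have "nat (int (a j) + 1) = Suc (a j)" "nat (int j + 0) = j" by simp_all
      ultimately show ?thesis using bspec[OF *(4) jd] unfolding int_choose_def by auto
    qed
    then have "(\<Sum>j=\<delta>..N. int_choose (int (a j) + 1) (int j + 0))
        = int (\<Sum>j=\<delta>..N. (a j choose j) + (a j choose (j - 1)))"
      by simp
    also have "\<dots> = int (r + shadow N r)"
      using shadow_macaulay_rep[OF *(1-4)] *(5) by (simp add: sum.distrib)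
    finally show ?thesis .
  qed
  obtain \<delta> a where "macaulay_rep r N \<delta> a" using macaulay_rep_exists[OF assms] by blast
  then have "\<exists>\<delta> a. macaulay_rep r N \<delta> a \<and>
      int (r + shadow N r) = (\<Sum>j=\<delta>..N. int_choose (int (a j) + 1) (int j + 0))"
    using val by metis
  then show ?thesis
    unfolding macaulay_def by (rule the_equality) (use val in blast)
qed

section \<open>Ranks and factorizations\<close>

text \<open>Padding with zero equations makes the system square; expansion along the zero row
  \<open>k\<close> shows that its determinant vanishes.\<close>

lemma homogeneous_system_nat:
  fixes a :: "nat \<Rightarrow> nat \<Rightarrow> 'a::field"
  assumes "k < l"
  shows "\<exists>x. (\<exists>j<l. x j \<noteq> 0) \<and> (\<forall>i<k. (\<Sum>j<l. a i j * x j) = 0)"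
proof -
  let ?A = "mat l l (\<lambda>(i, j). if i < k then a i j else 0)"
  have "row ?A k = 0\<^sub>v l" using assms by (intro eq_vecI) auto
  have "det ?A = (\<Sum>j<l. ?A $$ (k, j) * cofactor ?A k j)"
    using assms by (intro laplace_expansion_row) auto
  then have "det ?A = 0" using assms by simp
  then obtain v where v: "v \<in> carrier_vec l" "v \<noteq> 0\<^sub>v l" "?A *\<^sub>v v = 0\<^sub>v l"
    using det_0_iff_vec_prod_zero_field[of ?A l] by auto
  have "(\<Sum>j<l. a i j * v $ j) = 0" if "i < k" for i
  proof -
    have "(?A *\<^sub>v v) $ i = (\<Sum>j<l. a i j * v $ j)"
      using that assms v(1) by (simp add: scalar_prod_def atLeast0LessThan)
    then show ?thesis using v that assms by simp
  qed
  moreover have "\<exists>j<l. v $ j \<noteq> 0" using v by (auto simp: vec_eq_iff)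
  ultimately show ?thesis by blast
qed

lemma homogeneous_system:
  fixes a :: "'i \<Rightarrow> 'j \<Rightarrow> 'a::field"
  assumes I: "finite I" and J: "finite J" and "card I < card J"
  obtains x where "\<exists>j\<in>J. x j \<noteq> 0" "\<And>i. i \<in> I \<Longrightarrow> (\<Sum>j\<in>J. a i j * x j) = 0"
proof -
  obtain f g where f: "bij_betw f {..<card I} I" and g: "bij_betw g {..<card J} J"
    using ex_bij_betw_nat_finite[OF I] ex_bij_betw_nat_finite[OF J] by (auto simp: atLeast0LessThan)
  obtain x where x: "\<exists>j<card J. x j \<noteq> 0" "\<forall>i<card I. (\<Sum>j<card J. a (f i) (g j) * x j) = 0"
    using homogeneous_system_nat[OF assms(3), of "\<lambda>i j. a (f i) (g j)"] by blast
  let ?y = "\<lambda>j. x (the_inv_into {..<card J} g j)"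
  have inv: "?y (g j) = x j" if "j < card J" for j
    using that g by (simp add: the_inv_into_f_f bij_betw_def)
  show ?thesis
  proof
    show "\<exists>j\<in>J. ?y j \<noteq> 0" using x(1) inv g by (metis bij_betwE lessThan_iff)
    fix i assume "i \<in> I"
    then obtain k where k: "k < card I" "i = f k" using f by (auto simp: bij_betw_def)
    have "(\<Sum>j\<in>J. a i j * ?y j) = (\<Sum>j<card J. a (f k) (g j) * ?y (g j))"
      unfolding k(2) by (rule sum.reindex_bij_betw[OF g, symmetric])
    also have "\<dots> = 0" using x(2) k inv by simp
    finally show "(\<Sum>j\<in>J. a i j * ?y j) = 0" .
  qed
qed

text \<open>A maximal independent set of columns spans all columns: \<open>g\<close> lists its
  vectors and \<open>f\<close> the coordinates of the columns in it.\<close>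

lemma (in vec_space) rank_factorization_exists:
  assumes A: "A \<in> carrier_mat n nc"
  shows "\<exists>f g. \<forall>i<n. \<forall>j<nc. A $$ (i, j) = (\<Sum>k<rank A. f k j * g k i)"
proof -
  let ?P = "\<lambda>T. T \<subseteq> set (cols A) \<and> lin_indpt T"
  have cc: "set (cols A) \<subseteq> carrier_vec n" using cols_dim A by blast
  obtain S where S: "finite S" "maximal S ?P"
    using maximal_exists_superset[of "set (cols A)" ?P "{}"]
    by (auto simp: lin_dep_def)
  then have SP: "S \<subseteq> set (cols A)" "lin_indpt S" by (auto simp: maximal_def)
  have rank: "rank A = card S" by (rule rank_card_indpt[OF A S(2)])
  have SC: "S \<subseteq> carrier_vec n" using SP cc by blast
  have "\<exists>a. v = lincomb a S" if v: "v \<in> set (cols A)" for v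
  proof -
    have "v \<in> span S"
    proof (rule ccontr)
      assume v': "v \<notin> span S"
      then have "v \<notin> S" using span_mem SC by blast
      moreover have "lin_indpt (S \<union> {v})"
        using lin_dep_iff_in_span[OF _ SP(2), of v] SC v v' cc \<open>v \<notin> S\<close> by auto
      ultimately show False using S(2) SP v unfolding maximal_def by blast
    qed
    then show ?thesis using finite_span[OF S(1)] SC by auto
  qed
  then obtain a where a: "\<And>v. v \<in> set (cols A) \<Longrightarrow> v = lincomb (a v) S" by metis
  obtain h where h: "bij_betw h {..<card S} S"
    using ex_bij_betw_nat_finite[OF S(1)] by (auto simp: atLeast0LessThan)
  define f where "f k j = a (col A j) (h k)" for k j
  define g where "g k i = h k $ i" for k i
  have "A $$ (i, j) = (\<Sum>k<rank A. f k j * g k i)" if ij: "i < n" "j < nc" for i j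
  proof -
    have "col A j \<in> set (cols A)" using ij A by (auto simp: cols_def)
    then have "col A j $ i = lincomb (a (col A j)) S $ i" using a by metis
    also have "\<dots> = (\<Sum>v\<in>S. a (col A j) v * v $ i)" using lincomb_index[OF ij(1) SC] .
    also have "\<dots> = (\<Sum>k<card S. a (col A j) (h k) * h k $ i)"
      by (rule sum.reindex_bij_betw[OF h, symmetric])
    finally show ?thesis using ij A by (simp add: f_def g_def rank)
  qed
  then show ?thesis by blast
qed

text \<open>For more than \<open>w\<close> independent columns, the \<open>w\<close> homogeneous
  equations given by their \<open>f\<close>-coordinates would have a nonzero solution, and its
  entries would be the coefficients of a linear relation among these columns.\<close>

lemma (in vec_space) rank_le_factorization:
  assumes A: "A \<in> carrier_mat n nc"
    and eq: "\<And>i j. i < n \<Longrightarrow> j < nc \<Longrightarrow> A $$ (i, j) = (\<Sum>k<w. f k j * g k i)"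
  shows "rank A \<le> w"
proof (rule ccontr)
  assume less: "\<not> rank A \<le> w"
  let ?P = "\<lambda>T. T \<subseteq> set (cols A) \<and> lin_indpt T"
  have cc: "set (cols A) \<subseteq> carrier_vec n" using cols_dim A by blast
  obtain S where S: "finite S" "maximal S ?P"
    using maximal_exists_superset[of "set (cols A)" ?P "{}"]
    by (auto simp: lin_dep_def)
  then have SP: "S \<subseteq> set (cols A)" "lin_indpt S" by (auto simp: maximal_def)
  have rank: "rank A = card S" by (rule rank_card_indpt[OF A S(2)])
  have SC: "S \<subseteq> carrier_vec n" using SP cc by blast
  have "\<forall>v\<in>S. \<exists>j. j < nc \<and> v = col A j"
    using SP(1) A by (fastforce simp: cols_def)
  from bchoice[OF this] obtain c where c: "\<And>v. v \<in> S \<Longrightarrow> c v < nc \<and> v = col A (c v)"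
    by blast
  obtain x where x: "\<exists>v\<in>S. x v \<noteq> 0" "\<And>k. k \<in> {..<w} \<Longrightarrow> (\<Sum>v\<in>S. f k (c v) * x v) = 0"
    using homogeneous_system[of "{..<w}" S "\<lambda>k v. f k (c v)"] less rank S(1) by auto
  have "lincomb x S = 0\<^sub>v n"
  proof (rule eq_vecI)
    fix i assume "i < dim_vec (0\<^sub>v n)"
    then have i: "i < n" by simp
    have "lincomb x S $ i = (\<Sum>v\<in>S. x v * v $ i)" by (rule lincomb_index[OF i SC])
    also have "\<dots> = (\<Sum>v\<in>S. x v * (\<Sum>k<w. f k (c v) * g k i))"
    proof (intro sum.cong refl)
      fix v assume "v \<in> S"
      then have "v $ i = A $$ (i, c v)" using c[of v] i A by (metis carrier_matD index_col)
      then show "x v * v $ i = x v * (\<Sum>k<w. f k (c v) * g k i)"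
        using eq i c[OF \<open>v \<in> S\<close>] by simp
    qed
    also have "\<dots> = (\<Sum>k<w. g k i * (\<Sum>v\<in>S. f k (c v) * x v))"
      by (simp add: sum_distrib_left mult_ac) (rule sum.swap)
    also have "\<dots> = 0" using x(2) by simp
    finally show "lincomb x S $ i = 0\<^sub>v n $ i" using i by simp
  qed (use SC S in \<open>simp add: lincomb_dim\<close>)
  with x(1) S(1) SP SC show False
    using lin_dep_crit[OF S(1) order.refl, where a = x] by auto
qed

text \<open>
  Frobenius' inequality for \<open>F\<^sup>T E G\<close>. If it failed, the homogeneous equations \<open>F u = cnj (E G v)\<close>
  and \<open>Y v = 0\<close> in \<open>u\<close> and \<open>cnj v\<close> would have a nonzero solution, yet
  \<open>(F u)\<^sup>T (E G v) = (X u)\<^sup>T (Y v) = 0\<close> says that the squared norm of \<open>E G v\<close> vanishes.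
\<close>

lemma rank_lower_bound:
  fixes F :: "'p \<Rightarrow> 'a \<Rightarrow> complex" and G :: "'p \<Rightarrow> 'b \<Rightarrow> complex" and E :: "'p \<Rightarrow> 'p \<Rightarrow> complex"
    and X :: "'l \<Rightarrow> 'a \<Rightarrow> complex" and Y :: "'l \<Rightarrow> 'b \<Rightarrow> complex"
  assumes fin: "finite P" "finite S" "finite T" "finite L"
    and fact: "\<And>\<alpha> \<beta>. \<alpha> \<in> S \<Longrightarrow> \<beta> \<in> T \<Longrightarrow>
      (\<Sum>p\<in>P. \<Sum>q\<in>P. F p \<alpha> * E p q * G q \<beta>) = (\<Sum>l\<in>L. X l \<alpha> * Y l \<beta>)"
    and F: "\<And>u. (\<And>p. p \<in> P \<Longrightarrow> (\<Sum>\<alpha>\<in>S. F p \<alpha> * u \<alpha>) = 0) \<Longrightarrow> \<forall>\<alpha>\<in>S. u \<alpha> = 0"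
    and G: "\<And>v. (\<And>p. p \<in> P \<Longrightarrow> (\<Sum>\<beta>\<in>T. G p \<beta> * v \<beta>) = 0) \<Longrightarrow> \<forall>\<beta>\<in>T. v \<beta> = 0"
    and E: "\<And>x. (\<And>p. p \<in> P \<Longrightarrow> (\<Sum>q\<in>P. E p q * x q) = 0) \<Longrightarrow> \<forall>q\<in>P. x q = 0"
  shows "card S + card T \<le> card P + card L"
proof (rule ccontr)
  define H where "H p \<beta> = (\<Sum>q\<in>P. E p q * G q \<beta>)" for p \<beta>
  define a where "a i j = (case i of
      Inl p \<Rightarrow> (case j of Inl \<alpha> \<Rightarrow> F p \<alpha> | Inr \<beta> \<Rightarrow> - cnj (H p \<beta>))
    | Inr l \<Rightarrow> (case j of Inl \<alpha> \<Rightarrow> 0 | Inr \<beta> \<Rightarrow> cnj (Y l \<beta>)))" for i :: "'p + 'l" and j :: "'a + 'b"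
  assume "\<not> card S + card T \<le> card P + card L"
  then have "card (P <+> L) < card (S <+> T)" using fin by (simp add: card_Plus)
  then obtain x where nz: "\<exists>j\<in>S <+> T. x j \<noteq> 0"
    and x: "\<And>i. i \<in> P <+> L \<Longrightarrow> (\<Sum>j\<in>S <+> T. a i j * x j) = 0"
    using homogeneous_system[of "P <+> L" "S <+> T" a] fin by auto
  define u where "u \<alpha> = x (Inl \<alpha>)" for \<alpha>
  \<comment> \<open>The second family of unknowns is the conjugate of \<open>v\<close>, which keeps
    the equations complex linear; hence the conjugated entries of \<open>a\<close>.\<close>
  define v where "v \<beta> = cnj (x (Inr \<beta>))" for \<beta>
  have split: "(\<Sum>j\<in>S <+> T. g j) = (\<Sum>\<alpha>\<in>S. g (Inl \<alpha>)) + (\<Sum>\<beta>\<in>T. g (Inr \<beta>))" for g :: "'a + 'b \<Rightarrow> complex"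
    using fin by (simp add: sum.Plus)
  have conj_eq: "(\<Sum>\<alpha>\<in>S. F p \<alpha> * u \<alpha>) = cnj (\<Sum>\<beta>\<in>T. H p \<beta> * v \<beta>)" if "p \<in> P" for p
  proof -
    have "(\<Sum>\<alpha>\<in>S. F p \<alpha> * u \<alpha>) - cnj (\<Sum>\<beta>\<in>T. H p \<beta> * v \<beta>) = 0"
      using x[OF InlI[OF that]] by (simp add: split a_def u_def v_def sum_negf)
    then show ?thesis by simp
  qed
  have Y0: "(\<Sum>\<beta>\<in>T. Y l \<beta> * v \<beta>) = 0" if "l \<in> L" for l
  proof -
    have "cnj (\<Sum>\<beta>\<in>T. Y l \<beta> * v \<beta>) = 0"
      using x[OF InrI[OF that]] by (simp add: split a_def v_def)
    then show ?thesis by (simp only: complex_cnj_zero_iff)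
  qed
  define y where "y p = (\<Sum>\<beta>\<in>T. H p \<beta> * v \<beta>)" for p
  have "(\<Sum>p\<in>P. cnj (y p) * y p) = (\<Sum>p\<in>P. (\<Sum>\<alpha>\<in>S. F p \<alpha> * u \<alpha>) * (\<Sum>\<beta>\<in>T. H p \<beta> * v \<beta>))"
    using conj_eq by (simp add: y_def)
  also have "\<dots> = (\<Sum>p\<in>P. \<Sum>\<alpha>\<in>S. \<Sum>\<beta>\<in>T. u \<alpha> * v \<beta> * (F p \<alpha> * H p \<beta>))"
    by (simp add: sum_product mult_ac)
  also have "\<dots> = (\<Sum>\<alpha>\<in>S. \<Sum>p\<in>P. \<Sum>\<beta>\<in>T. u \<alpha> * v \<beta> * (F p \<alpha> * H p \<beta>))"
    by (rule sum.swap)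
  also have "\<dots> = (\<Sum>\<alpha>\<in>S. \<Sum>\<beta>\<in>T. \<Sum>p\<in>P. u \<alpha> * v \<beta> * (F p \<alpha> * H p \<beta>))"
    by (intro sum.cong refl sum.swap)
  also have "\<dots> = (\<Sum>\<alpha>\<in>S. \<Sum>\<beta>\<in>T. u \<alpha> * v \<beta> * (\<Sum>l\<in>L. X l \<alpha> * Y l \<beta>))"
  proof (intro sum.cong refl)
    fix \<alpha> \<beta> assume "\<alpha> \<in> S" "\<beta> \<in> T"
    then have "(\<Sum>p\<in>P. F p \<alpha> * H p \<beta>) = (\<Sum>l\<in>L. X l \<alpha> * Y l \<beta>)"
      unfolding fact[OF \<open>\<alpha> \<in> S\<close> \<open>\<beta> \<in> T\<close>, symmetric] by (simp add: H_def sum_distrib_left mult.assoc)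
    then show "(\<Sum>p\<in>P. u \<alpha> * v \<beta> * (F p \<alpha> * H p \<beta>)) = u \<alpha> * v \<beta> * (\<Sum>l\<in>L. X l \<alpha> * Y l \<beta>)"
      by (simp flip: sum_distrib_left)
  qed
  also have "\<dots> = (\<Sum>\<alpha>\<in>S. \<Sum>\<beta>\<in>T. \<Sum>l\<in>L. u \<alpha> * X l \<alpha> * (Y l \<beta> * v \<beta>))"
    by (simp add: sum_distrib_left mult_ac)
  also have "\<dots> = (\<Sum>\<alpha>\<in>S. \<Sum>l\<in>L. \<Sum>\<beta>\<in>T. u \<alpha> * X l \<alpha> * (Y l \<beta> * v \<beta>))"
    by (intro sum.cong refl sum.swap)
  also have "\<dots> = 0"
    using Y0 by (simp flip: sum_distrib_left)
  finally have "(\<Sum>p\<in>P. cnj (y p) * y p) = 0" .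
  moreover have "cnj (y p) * y p = of_real ((cmod (y p))\<^sup>2)" for p
    using complex_norm_square[of "y p"] by (simp add: mult.commute)
  ultimately have "complex_of_real (\<Sum>p\<in>P. (cmod (y p))\<^sup>2) = 0" by simp
  then have "(\<Sum>p\<in>P. (cmod (y p))\<^sup>2) = 0" by (simp only: of_real_eq_0_iff)
  then have y0: "y p = 0" if "p \<in> P" for p
    using that fin(1) by (simp add: sum_nonneg_eq_0_iff)
  have u0: "\<forall>\<alpha>\<in>S. u \<alpha> = 0"
  proof (rule F)
    fix p assume "p \<in> P"
    then show "(\<Sum>\<alpha>\<in>S. F p \<alpha> * u \<alpha>) = 0"
      using y0 unfolding conj_eq[OF \<open>p \<in> P\<close>] y_def by (metis complex_cnj_zero)
  qed
  have "\<forall>q\<in>P. (\<Sum>\<beta>\<in>T. G q \<beta> * v \<beta>) = 0"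
  proof (rule E)
    fix p assume "p \<in> P"
    have "(\<Sum>q\<in>P. E p q * (\<Sum>\<beta>\<in>T. G q \<beta> * v \<beta>)) = (\<Sum>q\<in>P. \<Sum>\<beta>\<in>T. E p q * G q \<beta> * v \<beta>)"
      by (simp add: sum_distrib_left mult.assoc)
    also have "\<dots> = (\<Sum>\<beta>\<in>T. \<Sum>q\<in>P. E p q * G q \<beta> * v \<beta>)" by (rule sum.swap)
    also have "\<dots> = y p" by (simp add: y_def H_def sum_distrib_right)
    finally show "(\<Sum>q\<in>P. E p q * (\<Sum>\<beta>\<in>T. G q \<beta> * v \<beta>)) = 0" using y0 \<open>p \<in> P\<close> by simp
  qed
  then have v0: "\<forall>\<beta>\<in>T. v \<beta> = 0" by (intro G) blast
  show False using nz u0 v0 by (auto simp: u_def v_def)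
qed

text \<open>The relation is solved for \<open>f k0\<close>, whose contribution is absorbed into the
  other \<open>g k\<close>. A factorization of minimal length therefore admits no such
  relation.\<close>

lemma factorization_reduce:
  fixes f :: "'k \<Rightarrow> 'a \<Rightarrow> 'c::field" and g :: "'k \<Rightarrow> 'b \<Rightarrow> 'c"
  assumes K: "finite K" "k0 \<in> K" and c: "c k0 \<noteq> 0"
    and dep: "\<And>\<alpha>. \<alpha> \<in> D \<Longrightarrow> (\<Sum>k\<in>K. c k * f k \<alpha>) = 0"
  shows "\<exists>g'. \<forall>\<alpha>\<in>D. \<forall>\<beta>. (\<Sum>k\<in>K. f k \<alpha> * g k \<beta>) = (\<Sum>k\<in>K - {k0}. f k \<alpha> * g' k \<beta>)"
proof (intro exI ballI allI)
  fix \<alpha> \<beta> assume "\<alpha> \<in> D"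
  then have "c k0 * f k0 \<alpha> + (\<Sum>k\<in>K - {k0}. c k * f k \<alpha>) = 0"
    using dep K by (simp add: sum.remove)
  then have "f k0 \<alpha> = - (\<Sum>k\<in>K - {k0}. c k * f k \<alpha>) / c k0"
    using c by (simp add: field_simps add_eq_0_iff)
  then have "f k0 \<alpha> * g k0 \<beta> = - (\<Sum>k\<in>K - {k0}. f k \<alpha> * (c k / c k0 * g k0 \<beta>))"
    by (simp add: sum_distrib_left sum_distrib_right sum_divide_distrib mult_ac)
  then show "(\<Sum>k\<in>K. f k \<alpha> * g k \<beta>)
      = (\<Sum>k\<in>K - {k0}. f k \<alpha> * (\<lambda>k \<beta>. g k \<beta> - c k / c k0 * g k0 \<beta>) k \<beta>)"
    using K by (simp add: sum.remove right_diff_distrib sum_subtractf)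
qed

section \<open>Leading exponents of a space of forms\<close>

definition lead_set :: "nat \<Rightarrow> (nat \<Rightarrow> 'a::linorder \<Rightarrow> complex) \<Rightarrow> 'a set" where
  "lead_set r f = {a. \<exists>c. (\<Sum>k<r. c k * f k a) \<noteq> 0 \<and> (\<forall>\<alpha>>a. (\<Sum>k<r. c k * f k \<alpha>) = 0)}"

lemma lead_set_subset:
  assumes "\<And>k \<alpha>. k < r \<Longrightarrow> \<alpha> \<notin> D \<Longrightarrow> f k \<alpha> = 0"
  shows "lead_set r f \<subseteq> D"
proof
  fix a assume "a \<in> lead_set r f"
  then obtain c where "(\<Sum>k<r. c k * f k a) \<noteq> 0" by (auto simp: lead_set_def)
  then show "a \<in> D" using assms by (metis (no_types, lifting) lessThan_iff mult_zero_right sum.neutral)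
qed

text \<open>With fewer than \<open>r\<close> leading exponents, some nontrivial combination would
  vanish at all of them. Independence makes it a nonzero form, and its own leading exponent is one
  of them.\<close>

lemma card_lead_set:
  fixes f :: "nat \<Rightarrow> 'a::linorder \<Rightarrow> complex"
  assumes D: "finite D" and supp: "\<And>k \<alpha>. k < r \<Longrightarrow> \<alpha> \<notin> D \<Longrightarrow> f k \<alpha> = 0"
    and indep: "\<And>c. (\<And>\<alpha>. \<alpha> \<in> D \<Longrightarrow> (\<Sum>k<r. c k * f k \<alpha>) = 0) \<Longrightarrow> \<forall>k<r. c k = 0"
  shows "r \<le> card (lead_set r f)"
proof (rule ccontr)
  assume less: "\<not> r \<le> card (lead_set r f)"
  have fin: "finite (lead_set r f)"
    using lead_set_subset[of r D f] supp D finite_subset by blast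
  obtain c where c: "\<exists>k\<in>{..<r}. c k \<noteq> 0"
    "\<And>a. a \<in> lead_set r f \<Longrightarrow> (\<Sum>k<r. f k a * c k) = 0"
    using homogeneous_system[of "lead_set r f" "{..<r}" "\<lambda>a k. f k a"] fin less by auto
  define h where "h \<alpha> = (\<Sum>k<r. c k * f k \<alpha>)" for \<alpha>
  define N where "N = {\<alpha>. h \<alpha> \<noteq> 0}"
  have sub: "N \<subseteq> D"
  proof
    fix \<alpha> assume "\<alpha> \<in> N"
    then have "(\<Sum>k<r. c k * f k \<alpha>) \<noteq> 0" by (simp add: N_def h_def)
    then obtain k where "k < r" "c k * f k \<alpha> \<noteq> 0" by (meson lessThan_iff sum.not_neutral_contains_not_neutral)
    then show "\<alpha> \<in> D" using supp by fastforce
  qed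
  have "N \<noteq> {}"
  proof
    assume "N = {}"
    then have "(\<Sum>k<r. c k * f k \<alpha>) = 0" for \<alpha> by (auto simp: N_def h_def)
    then have "\<forall>k<r. c k = 0" by (intro indep)
    with c(1) show False by auto
  qed
  have finN: "finite N" using sub D finite_subset by blast
  define a where "a = Max N"
  have a: "h a \<noteq> 0" using Max_in[OF finN \<open>N \<noteq> {}\<close>] by (simp add: a_def N_def)
  have "h \<alpha> = 0" if "\<alpha> > a" for \<alpha>
  proof (rule ccontr)
    assume "h \<alpha> \<noteq> 0"
    then have "\<alpha> \<le> a" using finN by (simp add: a_def N_def)
    with that show False by simp
  qed
  then have "a \<in> lead_set r f" using a unfolding lead_set_def h_def by blast
  then have "h a = 0" using c(2) by (simp add: h_def mult.commute)
  with a show False by simp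
qed

section \<open>Multiplication by a nondegenerate Hermitian form\<close>

text \<open>The coefficient function of z_i f. The case distinction guards against truncated
  subtraction of exponents.\<close>

definition times_var :: "nat \<Rightarrow> (monomial \<Rightarrow> complex) \<Rightarrow> monomial \<Rightarrow> complex" where
  "times_var i f \<alpha> = (if Poly_Mapping.lookup \<alpha> i = 0 then 0 else f (\<alpha> - Poly_Mapping.single i 1))"

lemma minus_single_add:
  fixes \<alpha> :: monomial
  assumes "Poly_Mapping.lookup \<alpha> i \<noteq> 0"
  shows "\<alpha> - Poly_Mapping.single i 1 + Poly_Mapping.single i 1 = \<alpha>"
  using assms by (intro poly_mapping_eqI) (auto simp: lookup_add lookup_minus lookup_single when_def)

lemma add_single_ne_0: "Poly_Mapping.lookup (\<alpha> + Poly_Mapping.single i (1::nat)) i \<noteq> 0"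
  by (simp add: lookup_add)

lemma times_var_add: "times_var i f (\<alpha> + Poly_Mapping.single i 1) = f \<alpha>"
  by (simp add: times_var_def lookup_add)

lemma mdeg_eq_sum:
  assumes "Poly_Mapping.keys \<alpha> \<subseteq> {..<n}"
  shows "mdeg \<alpha> = (\<Sum>i<n. Poly_Mapping.lookup \<alpha> i)"
  unfolding mdeg_def using assms by (intro sum.mono_neutral_left) (auto simp: in_keys_iff)

lemma add_single_in_monomials_iff:
  assumes "i < n"
  shows "\<alpha> + Poly_Mapping.single i 1 \<in> monomials n (Suc d) \<longleftrightarrow> \<alpha> \<in> monomials n d"
proof -
  have keys: "Poly_Mapping.keys (\<alpha> + Poly_Mapping.single i 1) = insert i (Poly_Mapping.keys \<alpha>)"
    by (auto simp: in_keys_iff lookup_add lookup_single when_def split: if_splits)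
  have "mdeg (\<alpha> + Poly_Mapping.single i 1) = Suc (mdeg \<alpha>)" if "Poly_Mapping.keys \<alpha> \<subseteq> {..<n}"
  proof -
    have "(\<Sum>k<n. Poly_Mapping.lookup (Poly_Mapping.single i 1) k) = (\<Sum>k<n. if k = i then 1 else 0 :: nat)"
      by (intro sum.cong) (auto simp: lookup_single when_def)
    then have "(\<Sum>k<n. Poly_Mapping.lookup (Poly_Mapping.single i 1) k) = (1::nat)"
      using assms by simp
    moreover have "mdeg (\<alpha> + Poly_Mapping.single i 1)
        = (\<Sum>k<n. Poly_Mapping.lookup (\<alpha> + Poly_Mapping.single i 1) k)"
      using that assms keys by (intro mdeg_eq_sum) auto
    ultimately show ?thesis using mdeg_eq_sum[OF that] by (simp add: lookup_add sum.distrib)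
  qed
  then show ?thesis using assms by (auto simp: monomials_def keys simp del: One_nat_def)
qed

lemma minus_single_in_monomials:
  assumes "\<alpha> \<in> monomials n (Suc d)" "i < n" "Poly_Mapping.lookup \<alpha> i \<noteq> 0"
  shows "\<alpha> - Poly_Mapping.single i 1 \<in> monomials n d"
  using add_single_in_monomials_iff[OF assms(2)] minus_single_add[OF assms(3)] assms(1) by metis

lemma lookup_mult_single_add:
  fixes M :: "'a::cancel_comm_monoid_add \<Rightarrow>\<^sub>0 'b::semiring_0"
  shows "Poly_Mapping.lookup (M * Poly_Mapping.single s c) (l + s) = Poly_Mapping.lookup M l * c"
proof -
  have "(\<Sum>q. Poly_Mapping.lookup (Poly_Mapping.single s c) q when l + s = l' + q) = (c when l' = l)" for l'
  proof (cases "l' = l")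
    case True
    then have "(Poly_Mapping.lookup (Poly_Mapping.single s c) q when l + s = l' + q) = (c when q = s)" for q
      by (auto simp: lookup_single when_def)
    then show ?thesis using True by simp
  next
    case False
    have "(Poly_Mapping.lookup (Poly_Mapping.single s c) q when l + s = l' + q) = 0" for q
      using False by (auto simp: lookup_single when_def)
    then show ?thesis using False by simp
  qed
  then show ?thesis by (simp add: lookup_mult mult_when)
qed

lemma lookup_mult_single_eq_0:
  fixes M :: "'a::cancel_comm_monoid_add \<Rightarrow>\<^sub>0 'b::semiring_0"
  assumes "\<And>l. k \<noteq> l + s"
  shows "Poly_Mapping.lookup (M * Poly_Mapping.single s c) k = 0"
proof -
  have "(Poly_Mapping.lookup (Poly_Mapping.single s c) q when k = l + q) = 0" for l q
    using assms[of l] by (auto simp: lookup_single when_def)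
  then show ?thesis by (simp add: lookup_mult)
qed

lemma lookup_mult_norm_poly:
  "Poly_Mapping.lookup (M * norm_poly n B) (\<alpha>, \<beta>) = (\<Sum>i<n. \<Sum>j<n. B (unit_vec n i) (unit_vec n j) *
     (if Poly_Mapping.lookup \<alpha> i = 0 \<or> Poly_Mapping.lookup \<beta> j = 0 then 0
      else Poly_Mapping.lookup M (\<alpha> - Poly_Mapping.single i 1, \<beta> - Poly_Mapping.single j 1)))"
proof -
  have "Poly_Mapping.lookup (M * Poly_Mapping.single (Poly_Mapping.single i 1, Poly_Mapping.single j 1) c) (\<alpha>, \<beta>)
      = c * (if Poly_Mapping.lookup \<alpha> i = 0 \<or> Poly_Mapping.lookup \<beta> j = 0 then 0
          else Poly_Mapping.lookup M (\<alpha> - Poly_Mapping.single i 1, \<beta> - Poly_Mapping.single j 1))"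
    (is "Poly_Mapping.lookup (M * Poly_Mapping.single ?s c) _ = _") for i j c
  proof (cases "Poly_Mapping.lookup \<alpha> i = 0 \<or> Poly_Mapping.lookup \<beta> j = 0")
    case True
    have "(\<alpha>, \<beta>) \<noteq> l + ?s" for l
      using True add_single_ne_0[of "fst l" i] add_single_ne_0[of "snd l" j] by (cases l) auto
    then show ?thesis using True lookup_mult_single_eq_0[of "(\<alpha>, \<beta>)" ?s M c] by simp
  next
    case False
    let ?l = "(\<alpha> - Poly_Mapping.single i 1, \<beta> - Poly_Mapping.single j 1)"
    have "(\<alpha>, \<beta>) = ?l + ?s"
      using False minus_single_add[of \<alpha> i] minus_single_add[of \<beta> j] by simp
    then have "Poly_Mapping.lookup (M * Poly_Mapping.single ?s c) (\<alpha>, \<beta>)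
        = Poly_Mapping.lookup (M * Poly_Mapping.single ?s c) (?l + ?s)"
      by (rule arg_cong)
    also have "\<dots> = Poly_Mapping.lookup M ?l * c" by (rule lookup_mult_single_add)
    finally show ?thesis using False by (simp add: mult.commute)
  qed
  then show ?thesis by (simp add: norm_poly_def sum_distrib_left lookup_sum)
qed

lemma card_up_monomials:
  fixes A :: "monomial set"
  assumes "finite A" "1 \<le> n"
  shows "card A + shadow (n - 1) (card A) \<le> card ((\<lambda>(a, i). a + Poly_Mapping.single i 1) ` (A \<times> {..<n}))"
proof -
  obtain m where n: "n = Suc m" using assms(2) by (cases n) auto
  have inj: "inj_on Poly_Mapping.lookup X" for X :: "monomial set"
    by (simp add: inj_on_def)
  let ?S = "(\<lambda>(a, i). a + Poly_Mapping.single i 1) ` (A \<times> {..<n})"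
  have eq: "Poly_Mapping.lookup (a + Poly_Mapping.single i 1)
      = (Poly_Mapping.lookup a)(i := Suc (Poly_Mapping.lookup a i))" for a :: monomial and i
    by (auto simp: lookup_add lookup_single when_def fun_eq_iff)
  have "up n (Poly_Mapping.lookup ` A)
      = (\<lambda>(a, i). (Poly_Mapping.lookup a)(i := Suc (Poly_Mapping.lookup a i))) ` (A \<times> {..<n})"
    unfolding up_def by force
  also have "\<dots> = Poly_Mapping.lookup ` ?S"
    by (simp add: image_image case_prod_unfold eq del: One_nat_def)
  finally have "up n (Poly_Mapping.lookup ` A) = Poly_Mapping.lookup ` ?S" .
  then show ?thesis
    using card_up_ge[of "Poly_Mapping.lookup ` A" m] assms n by (simp add: card_image[OF inj])
qed

text \<open>
  For \<open>w\<close> in the radical the quadratic form satisfies \<open>Q (z + w) = Q z + Q w\<close>; in the diagonalizing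
  coordinates \<open>v\<close> of \<open>w\<close> this is tested on the multiples \<open>v\<^sub>i e\<^sub>i\<close> of the basis vectors.
\<close>

lemma form_nondegenerate:
  assumes B: "hermitian_form n B" and sig: "signature n B s t" "s + t = n"
    and x: "\<And>i. i < n \<Longrightarrow> (\<Sum>j<n. B (unit_vec n i) (unit_vec n j) * x j) = 0"
    and j: "j < n"
  shows "x j = 0"
proof -
  define b where "b i j = B (unit_vec n i) (unit_vec n j)" for i j
  have b_sym: "b j i = cnj (b i j)" for i j
    using B unfolding b_def hermitian_form_def by (blast intro: unit_vec_carrier)
  have single: "zeval n (Poly_Mapping.single (\<alpha>, \<beta>) c) z = c * meval n \<alpha> z * cnj (meval n \<beta> z)"
    for \<alpha> \<beta> c z by (simp add: zeval_def)
  have Q: "B z z = (\<Sum>i<n. \<Sum>j<n. b i j * z $ i * cnj (z $ j))" if "z \<in> carrier_vec n" for z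
    using zeval_norm_poly[OF B that]
    by (simp add: norm_poly_def zeval_sum single meval_single[simplified] b_def)
  \<comment> \<open>The form is conjugate linear in its second argument, so a kernel vector
    \<open>x\<close> of its matrix is the conjugate of a vector in the radical.\<close>
  define w where "w = vec n (\<lambda>j. cnj (x j))"
  have w: "w \<in> carrier_vec n" by (simp add: w_def)
  have x0: "(\<Sum>j<n. b i j * x j) = 0" if "i < n" for i using x[OF that] by (simp add: b_def)
  have add: "B (z + w) (z + w) = B z z + B w w" if z: "z \<in> carrier_vec n" for z
  proof -
    have zw: "z + w \<in> carrier_vec n" using z w by simp
    have 1: "(\<Sum>i<n. \<Sum>j<n. b i j * z $ i * cnj (w $ j)) = 0"
    proof -
      have "(\<Sum>i<n. \<Sum>j<n. b i j * z $ i * cnj (w $ j)) = (\<Sum>i<n. z $ i * (\<Sum>j<n. b i j * x j))"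
        by (simp add: w_def sum_distrib_left mult_ac)
      also have "\<dots> = 0" using x0 by simp
      finally show ?thesis .
    qed
    have "(\<Sum>i<n. \<Sum>j<n. b i j * w $ i * cnj (z $ j)) = (\<Sum>j<n. \<Sum>i<n. b i j * w $ i * cnj (z $ j))"
      by (rule sum.swap)
    also have "\<dots> = cnj (\<Sum>i<n. \<Sum>j<n. b i j * z $ i * cnj (w $ j))"
      by (simp add: b_sym[symmetric] mult_ac)
    finally have 2: "(\<Sum>i<n. \<Sum>j<n. b i j * w $ i * cnj (z $ j)) = 0" using 1 by simp
    have "B (z + w) (z + w) = (\<Sum>i<n. \<Sum>j<n. b i j * z $ i * cnj (z $ j) + b i j * z $ i * cnj (w $ j)
        + (b i j * w $ i * cnj (z $ j) + b i j * w $ i * cnj (w $ j)))"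
      unfolding Q[OF zw] using z w by (intro sum.cong refl) (simp add: algebra_simps)
    also have "\<dots> = B z z + B w w"
      unfolding sum.distrib 1 2 Q[OF z] Q[OF w] by simp
    finally show ?thesis .
  qed
  obtain A where A: "A \<in> carrier_mat n n" "invertible_mat A"
    and sgn: "\<And>z. z \<in> carrier_vec n \<Longrightarrow> B z z =
      of_real ((\<Sum>i<s. (cmod ((A *\<^sub>v z) $ i))\<^sup>2) - (\<Sum>i=s..<s+t. (cmod ((A *\<^sub>v z) $ i))\<^sup>2))"
    using sig(1) unfolding signature_def by blast
  obtain A' where A': "A' \<in> carrier_mat n n" "A * A' = 1\<^sub>m n" "A' * A = 1\<^sub>m n"
    using A unfolding invertible_mat_def inverts_mat_def
    by (metis carrier_mat_triv carrier_matD index_mult_mat(2,3) index_one_mat(2,3))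
  define \<epsilon> where "\<epsilon> i = (if i < s then 1 else - 1 :: real)" for i
  define q where "q v = (\<Sum>i<n. \<epsilon> i * (cmod (v $ i))\<^sup>2)" for v
  have Bq: "B z z = of_real (q (A *\<^sub>v z))" if "z \<in> carrier_vec n" for z
  proof -
    have "q v = (\<Sum>i<s. (cmod (v $ i))\<^sup>2) - (\<Sum>i=s..<s+t. (cmod (v $ i))\<^sup>2)" for v
    proof -
      have "q v = (\<Sum>i\<in>{..<s} \<union> {s..<s + t}. \<epsilon> i * (cmod (v $ i))\<^sup>2)"
        unfolding q_def using sig(2) by (intro sum.cong) auto
      also have "\<dots> = (\<Sum>i<s. \<epsilon> i * (cmod (v $ i))\<^sup>2) + (\<Sum>i=s..<s+t. \<epsilon> i * (cmod (v $ i))\<^sup>2)"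
        by (rule sum.union_disjoint) auto
      also have "(\<Sum>i=s..<s+t. \<epsilon> i * (cmod (v $ i))\<^sup>2) = - (\<Sum>i=s..<s+t. (cmod (v $ i))\<^sup>2)"
        unfolding sum_negf[symmetric] by (intro sum.cong) (auto simp: \<epsilon>_def)
      finally show ?thesis by (simp add: \<epsilon>_def)
    qed
    then show ?thesis using sgn[OF that] by simp
  qed
  define v where "v = A *\<^sub>v w"
  have v: "v \<in> carrier_vec n" using A w by (simp add: v_def)
  have "v $ i = 0" if i: "i < n" for i
  proof -
    \<comment> \<open>With coefficient \<open>v $ i\<close> the cross term is \<plusminus>2 |v_i|^2;
      with coefficient 1 it would detect only the real part of v_i.\<close>
    define y where "y = v $ i \<cdot>\<^sub>v unit_vec n i"
    have y: "y \<in> carrier_vec n" by (simp add: y_def)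
    define z where "z = A' *\<^sub>v y"
    have z: "z \<in> carrier_vec n" using A' y by (simp add: z_def)
    have Az: "A *\<^sub>v z = y" unfolding z_def using A A' y
      by (metis assoc_mult_mat_vec one_mult_mat_vec)
    have "A *\<^sub>v (z + w) = y + v"
      unfolding v_def using A z w Az by (simp add: mult_add_distrib_mat_vec)
    then have "q (y + v) = q y + q v"
      using add[OF z] Bq[OF z] Bq[OF w] Bq[of "z + w"] z w Az
      by (simp add: v_def flip: of_real_add)
    moreover have "q (y + v) = q y + q v + 2 * (\<epsilon> i * (cmod (v $ i))\<^sup>2)"
    proof -
      have "\<epsilon> k * (cmod ((y + v) $ k))\<^sup>2 = \<epsilon> k * (cmod (y $ k))\<^sup>2 + \<epsilon> k * (cmod (v $ k))\<^sup>2
          + (if k = i then 2 * (\<epsilon> i * (cmod (v $ i))\<^sup>2) else 0)" if "k < n" for k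
      proof (cases "k = i")
        case True
        have "cmod (v $ i + v $ i) = 2 * cmod (v $ i)" by (simp flip: mult_2 add: norm_mult)
        then show ?thesis using True v that by (simp add: y_def power2_eq_square algebra_simps)
      next
        case False
        then have "y $ k = 0" "(y + v) $ k = v $ k"
          using v y that i by (simp_all add: y_def index_unit_vec)
        then show ?thesis using False by simp
      qed
      then have "q (y + v) = (\<Sum>k<n. \<epsilon> k * (cmod (y $ k))\<^sup>2 + \<epsilon> k * (cmod (v $ k))\<^sup>2
          + (if k = i then 2 * (\<epsilon> i * (cmod (v $ i))\<^sup>2) else 0))"
        unfolding q_def by (intro sum.cong) auto
      then show ?thesis using i by (simp add: sum.distrib q_def)
    qed
    ultimately show ?thesis by (simp add: \<epsilon>_def split: if_splits)
  qed
  then have "v = 0\<^sub>v n" using v by (intro eq_vecI) auto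
  have "w = A' *\<^sub>v v"
    unfolding v_def using A A' w by (metis assoc_mult_mat_vec one_mult_mat_vec)
  also have "\<dots> = 0\<^sub>v n" unfolding \<open>v = 0\<^sub>v n\<close> using A' by auto
  finally have "w $ j = 0" using j by simp
  then show ?thesis using j by (simp add: w_def)
qed

section \<open>The rank of a polynomial as the minimal length of a factorization\<close>

lemma distinct_monomial_list: "distinct (monomial_list n d)"
  by (simp add: monomial_list_def)

lemma coeff_matrix_carrier:
  "coeff_matrix n d M \<in> carrier_mat (length (monomial_list n d)) (length (monomial_list n d))"
  by (simp add: coeff_matrix_def Let_def)

lemma zpoly_rank_factorization:
  "\<exists>f g. \<forall>\<alpha>\<in>monomials n d. \<forall>\<beta>\<in>monomials n d.
     Poly_Mapping.lookup M (\<alpha>, \<beta>) = (\<Sum>k<zpoly_rank n d M. f k \<alpha> * g k \<beta>)"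
proof -
  define ms where "ms = monomial_list n d"
  define idx where "idx = the_inv_into {..<length ms} ((!) ms)"
  have inj: "inj_on ((!) ms) {..<length ms}"
    by (intro inj_on_nth) (auto simp: ms_def distinct_monomial_list)
  have idx: "idx \<alpha> < length ms \<and> ms ! idx \<alpha> = \<alpha>" if "\<alpha> \<in> monomials n d" for \<alpha>
  proof -
    have "\<alpha> \<in> set ms" using that by (simp add: ms_def set_monomial_list)
    then obtain i where "i < length ms" "ms ! i = \<alpha>" by (auto simp: in_set_conv_nth)
    then show ?thesis using the_inv_into_f_f[OF inj, of i] by (auto simp: idx_def)
  qed
  obtain f g where fg: "\<forall>i<length ms. \<forall>j<length ms.
      coeff_matrix n d M $$ (i, j) = (\<Sum>k<zpoly_rank n d M. f k j * g k i)"
    using vec_space.rank_factorization_exists[OF coeff_matrix_carrier[of n d M]]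
    unfolding zpoly_rank_def ms_def by blast
  have "Poly_Mapping.lookup M (\<alpha>, \<beta>) = (\<Sum>k<zpoly_rank n d M. f k (idx \<alpha>) * g k (idx \<beta>))"
    if "\<alpha> \<in> monomials n d" "\<beta> \<in> monomials n d" for \<alpha> \<beta>
  proof -
    have "Poly_Mapping.lookup M (\<alpha>, \<beta>) = coeff_matrix n d M $$ (idx \<beta>, idx \<alpha>)"
      using idx[OF that(1)] idx[OF that(2)] by (simp add: coeff_matrix_def Let_def flip: ms_def)
    also have "\<dots> = (\<Sum>k<zpoly_rank n d M. f k (idx \<alpha>) * g k (idx \<beta>))"
      using fg idx[OF that(1)] idx[OF that(2)] by blast
    finally show ?thesis .
  qed
  then show ?thesis
    by (intro exI[of _ "\<lambda>k \<alpha>. f k (idx \<alpha>)"] exI[of _ "\<lambda>k \<beta>. g k (idx \<beta>)"]) simp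
qed

lemma zpoly_rank_le:
  assumes K: "finite K"
    and eq: "\<And>\<alpha> \<beta>. \<alpha> \<in> monomials n d \<Longrightarrow> \<beta> \<in> monomials n d \<Longrightarrow>
      Poly_Mapping.lookup M (\<alpha>, \<beta>) = (\<Sum>k\<in>K. f k \<alpha> * g k \<beta>)"
  shows "zpoly_rank n d M \<le> card K"
proof -
  define ms where "ms = monomial_list n d"
  obtain h where h: "bij_betw h {..<card K} K"
    using ex_bij_betw_nat_finite[OF K] by (auto simp: atLeast0LessThan)
  have in_mon: "ms ! i \<in> monomials n d" if "i < length ms" for i
    using nth_mem[OF that] by (simp add: ms_def set_monomial_list)
  have "coeff_matrix n d M $$ (i, j) = (\<Sum>k<card K. f (h k) (ms ! j) * g (h k) (ms ! i))"
    if "i < length ms" "j < length ms" for i j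
  proof -
    have "coeff_matrix n d M $$ (i, j) = Poly_Mapping.lookup M (ms ! j, ms ! i)"
      using that by (simp add: coeff_matrix_def Let_def flip: ms_def)
    also have "\<dots> = (\<Sum>k\<in>K. f k (ms ! j) * g k (ms ! i))" by (intro eq in_mon that)
    also have "\<dots> = (\<Sum>k<card K. f (h k) (ms ! j) * g (h k) (ms ! i))"
      by (rule sum.reindex_bij_betw[OF h, symmetric])
    finally show ?thesis .
  qed
  note entry = this
  show ?thesis
    unfolding zpoly_rank_def
    by (rule vec_space.rank_le_factorization[OF coeff_matrix_carrier,
          where f = "\<lambda>k j. f (h k) (ms ! j)" and g = "\<lambda>k i. g (h k) (ms ! i)"])
      (rule entry; simp add: ms_def)
qed

text \<open>A linear relation in either family would let \<open>factorization_reduce\<close> drop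
  one term, leaving a factorization shorter than \<open>zpoly_rank_le\<close> permits.\<close>

lemma zpoly_rank_factorization_independent:
  fixes f g :: "nat \<Rightarrow> monomial \<Rightarrow> complex"
  assumes eq: "\<And>\<alpha> \<beta>. \<alpha> \<in> monomials n d \<Longrightarrow> \<beta> \<in> monomials n d \<Longrightarrow>
      Poly_Mapping.lookup M (\<alpha>, \<beta>) = (\<Sum>k<zpoly_rank n d M. f k \<alpha> * g k \<beta>)"
  shows "(\<And>\<alpha>. \<alpha> \<in> monomials n d \<Longrightarrow> (\<Sum>k<zpoly_rank n d M. c k * f k \<alpha>) = 0) \<Longrightarrow> \<forall>k<zpoly_rank n d M. c k = 0"
    and "(\<And>\<alpha>. \<alpha> \<in> monomials n d \<Longrightarrow> (\<Sum>k<zpoly_rank n d M. c k * g k \<alpha>) = 0) \<Longrightarrow> \<forall>k<zpoly_rank n d M. c k = 0"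
proof -
  let ?r = "zpoly_rank n d M"
  have False if k: "k < ?r" and le: "?r \<le> card ({..<?r} - {k})" for k
  proof -
    have "card ({..<?r} - {k}) < card {..<?r}"
      using k by (intro psubset_card_mono) auto
    with le show False by simp
  qed
  note smaller = this
  show "\<forall>k<?r. c k = 0" if dep: "\<And>\<alpha>. \<alpha> \<in> monomials n d \<Longrightarrow> (\<Sum>k<?r. c k * f k \<alpha>) = 0"
  proof (rule ccontr)
    assume "\<not> (\<forall>k<?r. c k = 0)"
    then obtain k0 where k0: "k0 < ?r" "c k0 \<noteq> 0" by blast
    then obtain g' where g': "\<forall>\<alpha>\<in>monomials n d. \<forall>\<beta>.
        (\<Sum>k<?r. f k \<alpha> * g k \<beta>) = (\<Sum>k\<in>{..<?r} - {k0}. f k \<alpha> * g' k \<beta>)"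
      using factorization_reduce[of "{..<?r}" k0 c "monomials n d" f g] dep by auto
    have "?r \<le> card ({..<?r} - {k0})"
      by (rule zpoly_rank_le[where f = f and g = g']) (simp_all add: eq g')
    then show False using smaller k0(1) by blast
  qed
  show "\<forall>k<?r. c k = 0" if dep: "\<And>\<alpha>. \<alpha> \<in> monomials n d \<Longrightarrow> (\<Sum>k<?r. c k * g k \<alpha>) = 0"
  proof (rule ccontr)
    assume "\<not> (\<forall>k<?r. c k = 0)"
    then obtain k0 where k0: "k0 < ?r" "c k0 \<noteq> 0" by blast
    then obtain f' where f': "\<forall>\<beta>\<in>monomials n d. \<forall>\<alpha>.
        (\<Sum>k<?r. g k \<beta> * f k \<alpha>) = (\<Sum>k\<in>{..<?r} - {k0}. g k \<beta> * f' k \<alpha>)"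
      using factorization_reduce[of "{..<?r}" k0 c "monomials n d" g f] dep by auto
    have "?r \<le> card ({..<?r} - {k0})"
    proof (rule zpoly_rank_le[where f = f' and g = g])
      fix \<alpha> \<beta> assume *: "\<alpha> \<in> monomials n d" "\<beta> \<in> monomials n d"
      have "Poly_Mapping.lookup M (\<alpha>, \<beta>) = (\<Sum>k<?r. g k \<beta> * f k \<alpha>)"
        unfolding eq[OF *] by (simp add: mult.commute)
      also have "\<dots> = (\<Sum>k\<in>{..<?r} - {k0}. f' k \<alpha> * g k \<beta>)"
        using f' *(2) by (simp add: mult.commute)
      finally show "Poly_Mapping.lookup M (\<alpha>, \<beta>) = (\<Sum>k\<in>{..<?r} - {k0}. f' k \<alpha> * g k \<beta>)" .
    qed simp
    then show False using smaller k0(1) by blast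
  qed
qed

section \<open>Products of leading monomials with variables\<close>

definition lead_products :: "nat \<Rightarrow> nat \<Rightarrow> (nat \<Rightarrow> monomial \<Rightarrow> complex) \<Rightarrow> monomial set" where
  "lead_products n r f = (\<lambda>(a, i). a + Poly_Mapping.single i 1) ` (lead_set r f \<times> {..<n})"

text \<open>Let \<open>s\<close> be the least exponent where \<open>u\<close> is nonzero, and write
  it as a leading exponent \<open>a\<close> of some h times z_i. Pairing z_i h with \<open>u\<close>
  leaves only the term at \<open>s\<close>: below it \<open>u\<close> vanishes, above it z_i h does.
  Hence \<open>u s = 0\<close>, a contradiction.\<close>

lemma lead_products_separate:
  fixes u :: "monomial \<Rightarrow> complex"
  assumes fin: "finite (lead_products n r f)"
    and eq: "\<And>k i. k < r \<Longrightarrow> i < n \<Longrightarrow> (\<Sum>\<alpha>\<in>lead_products n r f. times_var i (f k) \<alpha> * u \<alpha>) = 0"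
  shows "\<forall>\<alpha>\<in>lead_products n r f. u \<alpha> = 0"
proof (rule ccontr)
  let ?S = "lead_products n r f"
  assume "\<not> (\<forall>\<alpha>\<in>?S. u \<alpha> = 0)"
  then have ne: "{\<alpha> \<in> ?S. u \<alpha> \<noteq> 0} \<noteq> {}" by blast
  define s where "s = Min {\<alpha> \<in> ?S. u \<alpha> \<noteq> 0}"
  have "s \<in> {\<alpha> \<in> ?S. u \<alpha> \<noteq> 0}" unfolding s_def using fin ne by (intro Min_in) auto
  then have s: "s \<in> ?S" "u s \<noteq> 0" by auto
  have low: "u \<alpha> = 0" if "\<alpha> \<in> ?S" "\<alpha> < s" for \<alpha>
  proof (rule ccontr)
    assume "u \<alpha> \<noteq> 0"
    then have "s \<le> \<alpha>" unfolding s_def using fin that by (intro Min_le) auto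
    with that show False by simp
  qed
  obtain a i where a: "a \<in> lead_set r f" and i: "i < n" and sa: "s = a + Poly_Mapping.single i 1"
    using s(1) by (auto simp: lead_products_def)
  obtain c where c: "(\<Sum>k<r. c k * f k a) \<noteq> 0" "\<And>\<alpha>. \<alpha> > a \<Longrightarrow> (\<Sum>k<r. c k * f k \<alpha>) = 0"
    using a by (auto simp: lead_set_def)
  have high: "(\<Sum>k<r. c k * times_var i (f k) \<alpha>) = 0" if "\<alpha> > s" for \<alpha>
  proof (cases "Poly_Mapping.lookup \<alpha> i = 0")
    case False
    have "a + Poly_Mapping.single i 1 < \<alpha> - Poly_Mapping.single i 1 + Poly_Mapping.single i 1"
      using that unfolding sa minus_single_add[OF False] .
    then have "a < \<alpha> - Poly_Mapping.single i 1" by (simp only: add_less_cancel_right)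
    then show ?thesis using c(2) False by (simp add: times_var_def)
  qed (simp add: times_var_def)
  have "(\<Sum>\<alpha>\<in>?S. (\<Sum>k<r. c k * times_var i (f k) \<alpha>) * u \<alpha>)
      = (\<Sum>\<alpha>\<in>?S. \<Sum>k<r. c k * (times_var i (f k) \<alpha> * u \<alpha>))"
    by (simp add: sum_distrib_right mult.assoc)
  also have "\<dots> = (\<Sum>k<r. \<Sum>\<alpha>\<in>?S. c k * (times_var i (f k) \<alpha> * u \<alpha>))" by (rule sum.swap)
  also have "\<dots> = 0" using eq i by (simp flip: sum_distrib_left)
  finally have zero: "(\<Sum>\<alpha>\<in>?S. (\<Sum>k<r. c k * times_var i (f k) \<alpha>) * u \<alpha>) = 0" .
  have "(\<Sum>\<alpha>\<in>?S. (\<Sum>k<r. c k * times_var i (f k) \<alpha>) * u \<alpha>)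
      = (\<Sum>\<alpha>\<in>{s}. (\<Sum>k<r. c k * times_var i (f k) \<alpha>) * u \<alpha>)"
  proof (rule sum.mono_neutral_right[OF fin])
    show "\<forall>\<alpha>\<in>?S - {s}. (\<Sum>k<r. c k * times_var i (f k) \<alpha>) * u \<alpha> = 0"
    proof
      fix \<alpha> assume "\<alpha> \<in> ?S - {s}"
      then show "(\<Sum>k<r. c k * times_var i (f k) \<alpha>) * u \<alpha> = 0"
        using low[of \<alpha>] high[of \<alpha>] by (cases "\<alpha>" s rule: linorder_cases) auto
    qed
  qed (use s in simp)
  also have "\<dots> = (\<Sum>k<r. c k * f k a) * u s"
    unfolding sa by (simp add: times_var_add del: One_nat_def)
  finally show False using zero c(1) s(2) by simp
qed

lemma lead_products_of_independent:
  assumes n: "1 \<le> n"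
    and supp: "\<And>k \<alpha>. k < r \<Longrightarrow> \<alpha> \<notin> monomials n d \<Longrightarrow> f k \<alpha> = 0"
    and indep: "\<And>c. (\<And>\<alpha>. \<alpha> \<in> monomials n d \<Longrightarrow> (\<Sum>k<r. c k * f k \<alpha>) = 0) \<Longrightarrow> \<forall>k<r. c k = 0"
  shows "finite (lead_products n r f)" "lead_products n r f \<subseteq> monomials n (Suc d)"
    and "r + shadow (n - 1) r \<le> card (lead_products n r f)"
proof -
  have sub: "lead_set r f \<subseteq> monomials n d" by (rule lead_set_subset) (rule supp)
  then have fin: "finite (lead_set r f)" using finite_monomials finite_subset by blast
  then show "finite (lead_products n r f)" by (simp add: lead_products_def)
  show "lead_products n r f \<subseteq> monomials n (Suc d)"
    using sub by (auto simp: lead_products_def add_single_in_monomials_iff simp del: One_nat_def)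
  have "r \<le> card (lead_set r f)"
    by (rule card_lead_set[OF finite_monomials supp indep])
  then have "r + shadow (n - 1) r \<le> card (lead_set r f) + shadow (n - 1) (card (lead_set r f))"
    by (intro add_mono shadow_mono)
  also have "\<dots> \<le> card (lead_products n r f)"
    unfolding lead_products_def by (rule card_up_monomials[OF fin n])
  finally show "r + shadow (n - 1) r \<le> card (lead_products n r f)" .
qed

theorem theorem3p1:
  fixes n d s t r R :: nat
    and M :: zpoly
    and B :: "complex vec \<Rightarrow> complex vec \<Rightarrow> complex"
  assumes "n \<ge> 2"
    and "M \<in> zpolys n" and "M \<noteq> 0"
    and "bihomogeneous d M" and "hermitian_poly n M"
    and "r = zpoly_rank n d M"
    and "hermitian_form n B" and "signature n B s t" and "s + t = n"
    and "R = zpoly_rank n (d + 1) (M * norm_poly n B)"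
  shows "2 * macaulay r (n - 1) 0 1 - int (r * n) \<le> int R \<and> R \<le> r * n"
proof -
  define b where "b i j = B (unit_vec n i) (unit_vec n j)" for i j
  obtain f0 g0 where fg0: "\<forall>\<alpha>\<in>monomials n d. \<forall>\<beta>\<in>monomials n d.
      Poly_Mapping.lookup M (\<alpha>, \<beta>) = (\<Sum>k<r. f0 k \<alpha> * g0 k \<beta>)"
    using zpoly_rank_factorization[of n d M] assms(6) by blast
  \<comment> \<open>The factorization leaves \<open>f0\<close> and \<open>g0\<close> arbitrary off
    degree \<open>d\<close>; extension by 0 confines the leading exponents to
    \<open>monomials n d\<close>.\<close>
  define f where "f k \<alpha> = (if \<alpha> \<in> monomials n d then f0 k \<alpha> else 0)" for k \<alpha>
  define g where "g k \<alpha> = (if \<alpha> \<in> monomials n d then g0 k \<alpha> else 0)" for k \<alpha>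
  have fg: "Poly_Mapping.lookup M (\<alpha>, \<beta>) = (\<Sum>k<r. f k \<alpha> * g k \<beta>)"
    if "\<alpha> \<in> monomials n d" "\<beta> \<in> monomials n d" for \<alpha> \<beta>
    using fg0 that by (simp add: f_def g_def)
  define P where "P = {..<r} \<times> {..<n}"
  define F where "F p = times_var (snd p) (f (fst p))" for p
  define G where "G p = times_var (snd p) (g (fst p))" for p
  define E where "E p q = (if fst p = fst q then b (snd p) (snd q) else 0)" for p q :: "nat \<times> nat"
  have finP: "finite P" and cardP: "card P = r * n" by (simp_all add: P_def)
  have sumP: "(\<Sum>p\<in>P. h p) = (\<Sum>k<r. \<Sum>i<n. h (k, i))" for h :: "nat \<times> nat \<Rightarrow> complex"
    unfolding P_def by (simp add: sum.cartesian_product)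
  have sumE: "(\<Sum>q\<in>P. E (k, i) q * x q) = (\<Sum>j<n. b i j * x (k, j))" if "k < r" for k i x
  proof -
    have "(\<Sum>q\<in>P. E (k, i) q * x q)
        = (\<Sum>k'<r. if k' = k then \<Sum>j<n. b i j * x (k, j) else 0)"
      unfolding sumP by (intro sum.cong) (auto simp: E_def)
    then show ?thesis using that by simp
  qed
  have prod: "Poly_Mapping.lookup (M * norm_poly n B) (\<alpha>, \<beta>) = (\<Sum>p\<in>P. F p \<alpha> * (\<Sum>q\<in>P. E p q * G q \<beta>))"
    if "\<alpha> \<in> monomials n (d + 1)" "\<beta> \<in> monomials n (d + 1)" for \<alpha> \<beta>
  proof -
    have "Poly_Mapping.lookup (M * norm_poly n B) (\<alpha>, \<beta>)
        = (\<Sum>i<n. \<Sum>j<n. b i j * (\<Sum>k<r. times_var i (f k) \<alpha> * times_var j (g k) \<beta>))"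
      unfolding lookup_mult_norm_poly b_def[symmetric]
    proof (intro sum.cong refl arg_cong2[where f = "(*)"])
      fix i j assume "i \<in> {..<n}" "j \<in> {..<n}"
      then show "(if Poly_Mapping.lookup \<alpha> i = 0 \<or> Poly_Mapping.lookup \<beta> j = 0 then 0
          else Poly_Mapping.lookup M (\<alpha> - Poly_Mapping.single i 1, \<beta> - Poly_Mapping.single j 1))
          = (\<Sum>k<r. times_var i (f k) \<alpha> * times_var j (g k) \<beta>)"
        using that fg[OF minus_single_in_monomials[of \<alpha> n d i] minus_single_in_monomials[of \<beta> n d j]]
        by (auto simp: times_var_def)
    qed
    also have "\<dots> = (\<Sum>i<n. \<Sum>j<n. \<Sum>k<r. times_var i (f k) \<alpha> * (b i j * times_var j (g k) \<beta>))"
      by (simp add: sum_distrib_left mult_ac)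
    also have "\<dots> = (\<Sum>i<n. \<Sum>k<r. \<Sum>j<n. times_var i (f k) \<alpha> * (b i j * times_var j (g k) \<beta>))"
      by (intro sum.cong refl sum.swap)
    also have "\<dots> = (\<Sum>k<r. \<Sum>i<n. \<Sum>j<n. times_var i (f k) \<alpha> * (b i j * times_var j (g k) \<beta>))"
      by (rule sum.swap)
    also have "\<dots> = (\<Sum>p\<in>P. F p \<alpha> * (\<Sum>q\<in>P. E p q * G q \<beta>))"
      unfolding sumP[of "\<lambda>p. F p \<alpha> * (\<Sum>q\<in>P. E p q * G q \<beta>)"]
      by (intro sum.cong refl) (simp add: sumE F_def G_def sum_distrib_left)
    finally show ?thesis .
  qed
  have upper: "R \<le> r * n"
    unfolding assms(10) cardP[symmetric]
    by (rule zpoly_rank_le[OF finP, where f = F and g = "\<lambda>p \<beta>. \<Sum>q\<in>P. E p q * G q \<beta>"]) (rule prod)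
  obtain X Y where XY: "\<forall>\<alpha>\<in>monomials n (d + 1). \<forall>\<beta>\<in>monomials n (d + 1).
      Poly_Mapping.lookup (M * norm_poly n B) (\<alpha>, \<beta>) = (\<Sum>l<R. X l \<alpha> * Y l \<beta>)"
    using zpoly_rank_factorization[of n "d + 1" "M * norm_poly n B"] assms(10) by blast
  have n1: "1 \<le> n" using assms(1) by simp
  have indep_f: "\<forall>k<r. c k = 0" if "\<And>\<alpha>. \<alpha> \<in> monomials n d \<Longrightarrow> (\<Sum>k<r. c k * f k \<alpha>) = 0" for c
    using zpoly_rank_factorization_independent(1)[of n d M f g c] fg that unfolding assms(6) by blast
  have indep_g: "\<forall>k<r. c k = 0" if "\<And>\<alpha>. \<alpha> \<in> monomials n d \<Longrightarrow> (\<Sum>k<r. c k * g k \<alpha>) = 0" for c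
    using zpoly_rank_factorization_independent(2)[of n d M f g c] fg that unfolding assms(6) by blast
  have supp_f: "f k \<alpha> = 0" and supp_g: "g k \<alpha> = 0" if "\<alpha> \<notin> monomials n d" for k \<alpha>
    using that by (simp_all add: f_def g_def)
  note S = lead_products_of_independent[of n r d f, OF n1 supp_f indep_f]
  note T = lead_products_of_independent[of n r d g, OF n1 supp_g indep_g]
  have "card (lead_products n r f) + card (lead_products n r g) \<le> card P + card {..<R}"
  proof (rule rank_lower_bound[where F = F and G = G and E = E and X = X and Y = Y])
    fix \<alpha> \<beta> assume "\<alpha> \<in> lead_products n r f" "\<beta> \<in> lead_products n r g"
    then have mon: "\<alpha> \<in> monomials n (d + 1)" "\<beta> \<in> monomials n (d + 1)"
      using S(2) T(2) by auto
    then show "(\<Sum>p\<in>P. \<Sum>q\<in>P. F p \<alpha> * E p q * G q \<beta>) = (\<Sum>l<R. X l \<alpha> * Y l \<beta>)"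
      using prod[OF mon] XY by (simp add: sum_distrib_left mult.assoc)
  next
    fix u assume u: "\<And>p. p \<in> P \<Longrightarrow> (\<Sum>\<alpha>\<in>lead_products n r f. F p \<alpha> * u \<alpha>) = 0"
    show "\<forall>\<alpha>\<in>lead_products n r f. u \<alpha> = 0"
    proof (rule lead_products_separate[OF S(1)])
      fix k i assume "k < r" "i < n"
      then show "(\<Sum>\<alpha>\<in>lead_products n r f. times_var i (f k) \<alpha> * u \<alpha>) = 0"
        using u[of "(k, i)"] by (simp add: F_def P_def)
    qed
  next
    fix u assume u: "\<And>p. p \<in> P \<Longrightarrow> (\<Sum>\<beta>\<in>lead_products n r g. G p \<beta> * u \<beta>) = 0"
    show "\<forall>\<beta>\<in>lead_products n r g. u \<beta> = 0"
    proof (rule lead_products_separate[OF T(1)])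
      fix k i assume "k < r" "i < n"
      then show "(\<Sum>\<beta>\<in>lead_products n r g. times_var i (g k) \<beta> * u \<beta>) = 0"
        using u[of "(k, i)"] by (simp add: G_def P_def)
    qed
  next
    fix x assume x: "\<And>p. p \<in> P \<Longrightarrow> (\<Sum>q\<in>P. E p q * x q) = 0"
    have "x (k, j) = 0" if k: "k < r" and j: "j < n" for k j
    proof (rule form_nondegenerate[OF assms(7-9) _ j])
      fix i assume "i < n"
      then show "(\<Sum>j<n. B (unit_vec n i) (unit_vec n j) * x (k, j)) = 0"
        using x[of "(k, i)"] sumE[OF k, of i x] k by (simp add: P_def b_def)
    qed
    then show "\<forall>q\<in>P. x q = 0" by (auto simp: P_def)
  qed (use finP S(1) T(1) in simp_all)
  then have bound: "2 * (r + shadow (n - 1) r) \<le> r * n + R"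
    using S(3) T(3) cardP by simp
  \<comment> \<open>\<open>macaulay_eq_shadow\<close> needs positive arguments:
    \<open>M \<noteq> 0\<close> provides \<open>1 \<le> r\<close>, and \<open>n \<ge> 2\<close>
    provides \<open>1 \<le> n - 1\<close>.\<close>
  have "1 \<le> r"
  proof (rule ccontr)
    assume "\<not> 1 \<le> r"
    obtain \<alpha> \<beta> where key: "(\<alpha>, \<beta>) \<in> Poly_Mapping.keys M"
      using assms(3) by (metis ex_in_conv keys_eq_empty surj_pair)
    then have "\<alpha> \<in> monomials n d" "\<beta> \<in> monomials n d"
      using assms(2,4) by (auto simp: zpolys_def bihomogeneous_def monomials_def)
    then have "Poly_Mapping.lookup M (\<alpha>, \<beta>) = 0" using fg \<open>\<not> 1 \<le> r\<close> by (simp add: not_le)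
    with key show False by (simp add: in_keys_iff)
  qed
  then have "macaulay r (n - 1) 0 1 = int (r + shadow (n - 1) r)"
    using assms(1) by (intro macaulay_eq_shadow) auto
  moreover have "2 * int (r + shadow (n - 1) r) \<le> int (r * n) + int R"
    using bound by (metis of_nat_add of_nat_le_iff of_nat_mult of_nat_numeral)
  ultimately show ?thesis using upper by (simp del: of_nat_mult)
qed

end
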